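(* Let $H$ be a separable real Hilbert space, let $K:=S_1^+(H)\times[0,\infty)$ and let $\tau_{\mathrm{w}^*}$ be the relative weak-$*$ topology on $K$ (with respect to the pairing $\langle\!\langle\cdot,\cdot\rangle\!\rangle$ defined in the context). Then: (i) $K$ is a convex cone in $S_1(H)\times\mathbb{R}$; (ii) for all $(A,x)\in S_1(H)\times\mathbb{R}$ it holds that $(A,x)\in K$ if and only if $\langle\!\langle(A,x),(B,y)\rangle\!\rangle\ge0$ for all $(B,y)\in S_c(H)\times[0,\infty)$ satisfying $B+y\operatorname{Id}\ge0$; (iii) $K$ is closed in $S_1(H)\times\mathbb{R}$ with respect to the weak-$*$ topology; (iv) $(K,\tau_{\mathrm{w}^*})$ is $\sigma$-compact and locally compact; (v) $(K,\tau_{\mathrm{w}^*})$ is separable and metrizable.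
   Context: $L_1(H)$ denotes the trace class operators on $H$, $S_1(H)$ the self-adjoint trace class operators, $S_1^+(H)$ those in $S_1(H)$ with spectrum in $[0,\infty)$, and $S_c(H)$ the compact self-adjoint operators; $\operatorname{tr}$ is the trace and $\operatorname{Id}$ the identity on $H$. For $(A,x)\in L_1(H)\times\mathbb{R}$ and a compact operator $B$ on $H$, $y\in\mathbb{R}$, define $$\langle\!\langle(A,x),(B,y)\rangle\!\rangle=\operatorname{tr}(B^*A)+(\operatorname{tr}(A)+x)\,y.$$ This pairing identifies $L_1(H)\times\mathbb{R}$ with the dual of (compact operators on $H$)$\,\times\mathbb{R}$ (via the isomorphism $(A,x)\mapsto(A,x+\operatorname{tr}A)$ and the canonical trace duality). The weak-$*$ topology on $L_1(H)\times\mathbb{R}$ (and its subsets) is the coarsest topology making all maps $(A,x)\mapsto\langle\!\langle(A,x),(B,y)\rangle\!\rangle$ continuous, $B$ compact, $y\in\mathbb{R}$. *)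

theory Defs
  imports "HOL-Analysis.Analysis"
begin

text \<open>
  Bounded operators on the real Hilbert space \<open>'a\<close> are elements of \<open>'a \<Rightarrow>\<^sub>L 'a\<close>.
\<close>

text \<open>By the Riesz representation theorem \<^const>\<open>adjoint\<close> yields a bounded linear map here.\<close>

definition blinfun_adjoint ::
    "('a::{real_inner,complete_space} \<Rightarrow>\<^sub>L 'a) \<Rightarrow> ('a \<Rightarrow>\<^sub>L 'a)" where
  "blinfun_adjoint A = Blinfun (adjoint (blinfun_apply A))"

definition selfadjoint_op :: "('a::{real_inner,complete_space} \<Rightarrow>\<^sub>L 'a) \<Rightarrow> bool" where
  "selfadjoint_op A \<longleftrightarrow> blinfun_adjoint A = A"

text \<open>
  Self-adjointness has to be required, since over the reals it does not follow from
  nonnegativity of the quadratic form.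
\<close>

definition nonneg_op :: "('a::{real_inner,complete_space} \<Rightarrow>\<^sub>L 'a) \<Rightarrow> bool" where
  "nonneg_op A \<longleftrightarrow> selfadjoint_op A \<and> (\<forall>x. 0 \<le> A x \<bullet> x)"

definition compact_op :: "('a::{real_inner,complete_space} \<Rightarrow>\<^sub>L 'a) \<Rightarrow> bool" where
  "compact_op A \<longleftrightarrow> compact (closure (blinfun_apply A ` cball 0 1))"

text \<open>
  The real spectrum.  It is used for self-adjoint operators only, for which it coincides with
  the spectrum of the complexification.
\<close>

definition spectrum_op :: "('a::{real_inner,complete_space} \<Rightarrow>\<^sub>L 'a) \<Rightarrow> real set" where
  "spectrum_op A =
    {l. \<not> (\<exists>C. C o\<^sub>L (A - l *\<^sub>R id_blinfun) = id_blinfun \<and>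
              (A - l *\<^sub>R id_blinfun) o\<^sub>L C = id_blinfun)}"

definition is_onb :: "'a::{real_inner,complete_space} set \<Rightarrow> bool" where
  "is_onb E \<longleftrightarrow> pairwise orthogonal E \<and> (\<forall>e\<in>E. norm e = 1) \<and> closure (span E) = UNIV"

text \<open>The modulus \<open>|A|\<close>: the unique nonnegative square root of \<open>A\<^sup>* A\<close>.\<close>

definition abs_op :: "('a::{real_inner,complete_space} \<Rightarrow>\<^sub>L 'a) \<Rightarrow> ('a \<Rightarrow>\<^sub>L 'a)" where
  "abs_op A = (THE P. nonneg_op P \<and> P o\<^sub>L P = blinfun_adjoint A o\<^sub>L A)"

text \<open>
  Neither the summability in \<open>trace_class\<close> nor, for trace class \<open>A\<close>, the value of \<open>trace_op A\<close>
  depends on the orthonormal basis.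
\<close>

definition trace_class :: "('a::{real_inner,complete_space} \<Rightarrow>\<^sub>L 'a) \<Rightarrow> bool" where
  "trace_class A \<longleftrightarrow> (\<exists>E. is_onb E \<and> (\<lambda>e. abs_op A e \<bullet> e) summable_on E)"

definition trace_op :: "('a::{real_inner,complete_space} \<Rightarrow>\<^sub>L 'a) \<Rightarrow> real" where
  "trace_op A = (\<Sum>\<^sub>\<infinity>e\<in>(SOME E. is_onb E). A e \<bullet> e)"

definition L1 :: "('a::{real_inner,complete_space} \<Rightarrow>\<^sub>L 'a) set" where
  "L1 = {A. trace_class A}"

definition S1 :: "('a::{real_inner,complete_space} \<Rightarrow>\<^sub>L 'a) set" where
  "S1 = {A \<in> L1. selfadjoint_op A}"

definition S1_plus :: "('a::{real_inner,complete_space} \<Rightarrow>\<^sub>L 'a) set" where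
  "S1_plus = {A \<in> S1. spectrum_op A \<subseteq> {0..}}"

definition Sc :: "('a::{real_inner,complete_space} \<Rightarrow>\<^sub>L 'a) set" where
  "Sc = {B. compact_op B \<and> selfadjoint_op B}"

definition pairing ::
    "('a::{real_inner,complete_space} \<Rightarrow>\<^sub>L 'a) \<times> real \<Rightarrow> ('a \<Rightarrow>\<^sub>L 'a) \<times> real \<Rightarrow> real" where
  "pairing = (\<lambda>(A, x) (B, y). trace_op (blinfun_adjoint B o\<^sub>L A) + (trace_op A + x) * y)"

text \<open>
  The coarsest topology on \<open>L1 \<times> \<real>\<close> making all \<open>\<lambda>p. pairing p q\<close>, \<open>q\<close> in
  (compact operators) \<open>\<times> \<real>\<close>, continuous: the preimages of open sets form a subbase.
\<close>

definition wstar_topology ::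
    "(('a::{real_inner,complete_space} \<Rightarrow>\<^sub>L 'a) \<times> real) topology" where
  "wstar_topology = topology_generated_by
    {{p \<in> L1 \<times> UNIV. pairing p q \<in> U} | q U. q \<in> {B. compact_op B} \<times> UNIV \<and> open U}"

definition sigma_compact_space :: "'b topology \<Rightarrow> bool" where
  "sigma_compact_space X \<longleftrightarrow>
    (\<exists>F::nat \<Rightarrow> 'b set. (\<forall>n. compactin X (F n)) \<and> (\<Union>n. F n) = topspace X)"

end

theory Submission
  imports Defs
begin

text \<open>
  Everything rests on one structural fact about a nonnegative operator \<open>A\<close> on a separable real Hilbert
  space: it is a weakly convergent sum \<open>A = \<Sum>\<^sub>k v\<^sub>k \<otimes> v\<^sub>k\<close> of rank one operators
  (\<open>rank_one_decomposition\<close>, an infinite Cholesky factorisation along a dense sequence).  If \<open>A\<close> is of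
  trace class, then \<open>tr A = \<Sum>\<^sub>k \<parallel>v\<^sub>k\<parallel>\<^sup>2\<close> and \<open>tr (B\<^sup>* A) = \<Sum>\<^sub>k \<langle>B v\<^sub>k, v\<^sub>k\<rangle>\<close> for every bounded \<open>B\<close>
  (\<open>trace_pairing_expansion\<close>), by interchanging absolutely convergent sums.  Hence the trace does not depend
  on the basis, \<open>\<bar>tr (B\<^sup>* A)\<bar> \<le> \<parallel>B\<parallel> tr A\<close>, and \<open>tr (B\<^sup>* A) \<ge> 0\<close> if the form of \<open>B\<close> is nonnegative.

  To bring these formulas to bear, the members of \<open>S1_plus\<close> have to be recognised as the nonnegative
  operators with summable diagonal.  The spectral condition is equivalent to nonnegativity of the quadratic
  form (\<open>selfadjoint_spectrum_nonneg_iff\<close>), and the modulus of a nonnegative operator is the operator itself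
  by uniqueness of nonnegative square roots (\<open>nonneg_op_sqrt_unique\<close>).  The cone property follows.

  For the duality statement, \<open>\<langle>\<langle>(A, x), (B, y)\<rangle>\<rangle> = tr ((B + y I) A) + x y\<close> is nonnegative on the cone.
  Conversely, rank one test operators \<open>u \<otimes> u\<close> force \<open>A \<ge> 0\<close>, and minus the finite rank projections
  together with \<open>y = 1\<close> force \<open>x \<ge> 0\<close>.  So the cone is an intersection of weak-* closed half-spaces.

  The topological statements come from the countably many coordinates \<open>\<langle>A d\<^sub>i, d\<^sub>j\<rangle>\<close>, with \<open>d\<close> a dense
  sequence, together with \<open>N = tr A + x\<close>.  They are weak-* continuous on the cone.  Conversely, suppose that
  they converge along a sequence in the cone.  Then \<open>N\<close> bounds the traces, so the operators converge weakly
  to some \<open>L \<ge> 0\<close>; lower semicontinuity of the trace leaves a nonnegative second component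
  \<open>lim N - tr L\<close>; and all pairings converge, since compact operators are norm limits of finite rank ones
  (\<open>cone_coords_limit\<close>).  Therefore the cone is homeomorphic to a closed subset of a countable product of real
  lines, which gives metrizability and separability; the sets \<open>{N \<le> c}\<close> are compact by Tychonoff's theorem
  and exhaust the cone, which gives \<open>\<sigma>\<close>-compactness, and the open sets \<open>{N < c}\<close> give local compactness.
\<close>

section \<open>Riesz representation and adjoints\<close>

text \<open>
  The representing vector is the minimiser of \<open>J x = \<parallel>x\<parallel>\<^sup>2 - 2 f x\<close>: for \<open>f = \<langle>u, \<cdot>\<rangle>\<close> one has
  \<open>J x = \<parallel>x - u\<parallel>\<^sup>2 - \<parallel>u\<parallel>\<^sup>2\<close>.  The parallelogram identity makes every minimising sequence Cauchy, and the
  vanishing of the first variation of \<open>J\<close> at its minimum is the representation formula.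
\<close>

lemma riesz_representation:
  fixes f :: "'a::{real_inner,complete_space} \<Rightarrow> real"
  assumes f: "bounded_linear f"
  shows "\<exists>u. \<forall>x. f x = u \<bullet> x"
proof -
  interpret f: bounded_linear f by (rule f)
  obtain K where K: "\<And>x. \<bar>f x\<bar> \<le> norm x * K" 
    using f.bounded by (auto simp: real_norm_def)
  define J where "J x = x \<bullet> x - 2 * f x" for x
  have J_lower: "- K\<^sup>2 \<le> J x" for x
  proof -
    have "2 * f x \<le> 2 * (norm x * K)" using K[of x] by linarith
    also have "\<dots> \<le> (norm x)\<^sup>2 + K\<^sup>2"
      using sum_squares_bound[of "norm x" K] by simp
    finally show ?thesis by (simp add: J_def power2_norm_eq_inner)
  qed
  define m where "m = Inf (range J)"
  have bdd: "bdd_below (range J)" using J_lower by (auto intro!: bdd_belowI)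
  have m_le: "m \<le> J x" for x
    unfolding m_def by (rule cInf_lower[OF _ bdd]) auto
  have "\<exists>x. J x < m + inverse (real (Suc n))" for n
  proof (rule ccontr)
    assume "\<not> ?thesis"
    then have "m + inverse (real (Suc n)) \<le> Inf (range J)"
      by (intro cInf_greatest) (auto simp: not_less)
    then show False unfolding m_def[symmetric] by simp
  qed
  then obtain X where X: "\<And>n. J (X n) < m + inverse (real (Suc n))" by metis
  have para: "(norm (x - y))\<^sup>2 = 2 * J x + 2 * J y - 4 * J ((1/2) *\<^sub>R (x + y))" for x y
    by (simp add: J_def f.add f.scaleR power2_norm_eq_inner inner_simps inner_commute algebra_simps)
  have dist: "(norm (X i - X j))\<^sup>2 \<le> 4 * inverse (real (Suc n))" if "i \<ge> n" "j \<ge> n" for i j n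
  proof -
    have "inverse (real (Suc i)) \<le> inverse (real (Suc n))" "inverse (real (Suc j)) \<le> inverse (real (Suc n))"
      using that by (auto intro!: le_imp_inverse_le)
    then show ?thesis using X[of i] X[of j] m_le[of "(1/2) *\<^sub>R (X i + X j)"]
      unfolding para by linarith
  qed
  have "Cauchy X"
  proof (rule metric_CauchyI)
    fix e :: real assume "0 < e"
    then obtain n where n: "inverse (real (Suc n)) < e\<^sup>2 / 4"
      using reals_Archimedean[of "e\<^sup>2/4"] by auto
    have "dist (X i) (X j) < e" if "i \<ge> n" "j \<ge> n" for i j
    proof -
      have "(norm (X i - X j))\<^sup>2 < e\<^sup>2" using dist[OF that] n by linarith
      then show ?thesis using \<open>0 < e\<close> by (simp add: dist_norm power2_less_imp_less)
    qed
    then show "\<exists>M. \<forall>i\<ge>M. \<forall>j\<ge>M. dist (X i) (X j) < e" by blast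
  qed
  then obtain u where u: "X \<longlonglongrightarrow> u"
    using Cauchy_convergent convergent_def by blast
  have "(\<lambda>n. J (X n)) \<longlonglongrightarrow> J u"
    unfolding J_def by (intro tendsto_intros u f.tendsto)
  moreover have "(\<lambda>n. m + inverse (real (Suc n))) \<longlonglongrightarrow> m + 0"
    by (intro tendsto_intros LIMSEQ_inverse_real_of_nat)
  ultimately have "J u \<le> m"
    using X by (intro LIMSEQ_le[of "\<lambda>n. J (X n)" "J u" "\<lambda>n. m + inverse (real (Suc n))" m]) (auto intro: less_imp_le)
  then have min: "J u \<le> J x" for x using m_le[of x] by linarith
  have "f x = u \<bullet> x" for x
  proof -
    define b where "b = u \<bullet> x - f x"
    have quad: "0 \<le> 2 * t * b + t\<^sup>2 * (x \<bullet> x)" for t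
      using min[of "u + t *\<^sub>R x"]
      by (simp add: J_def b_def f.add f.scaleR inner_simps inner_commute algebra_simps power2_eq_square)
    have "b = 0"
    proof (cases "x \<bullet> x = 0")
      case True
      then show ?thesis by (simp add: b_def f.zero)
    next
      case False
      then have "x \<bullet> x > 0" by simp
      then have "0 \<le> - (b\<^sup>2 / (x \<bullet> x))"
        using quad[of "- b / (x \<bullet> x)"] by (simp add: field_simps power2_eq_square)
      then show ?thesis using \<open>x \<bullet> x > 0\<close> by (simp add: divide_le_0_iff)
    qed
    then show ?thesis by (simp add: b_def)
  qed
  then show ?thesis by blast
qed

text \<open>
  This is how operators are built below: adjoints here, and limits of sequences of operators later.
\<close>

lemma blinfun_of_bounded_form:
  fixes b :: "'a::{real_inner,complete_space} \<Rightarrow> 'a \<Rightarrow> real"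
  assumes b: "bounded_bilinear b"
  shows "\<exists>A :: 'a \<Rightarrow>\<^sub>L 'a. \<forall>x y. A x \<bullet> y = b x y"
proof -
  interpret b: bounded_bilinear b by (rule b)
  have "\<exists>u. \<forall>y. b x y = u \<bullet> y" for x
    by (rule riesz_representation) (rule b.bounded_linear_right)
  then obtain T where T: "\<And>x y. b x y = T x \<bullet> y" by metis
  obtain K where K0: "0 \<le> K" and K: "\<And>x y. norm (b x y) \<le> norm x * norm y * K"
    using b.nonneg_bounded by blast
  have "bounded_linear T"
  proof (rule bounded_linear_intro[where K=K])
    show "T (x + y) = T x + T y" for x y
      by (rule vector_eq_rdot[THEN iffD1]) (simp add: inner_simps flip: T add: b.add_left)
    show "T (r *\<^sub>R x) = r *\<^sub>R T x" for r x
      by (rule vector_eq_rdot[THEN iffD1]) (simp add: inner_simps flip: T add: b.scaleR_left)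
    show "norm (T x) \<le> norm x * K" for x
    proof (cases "T x = 0")
      case True then show ?thesis using K0 by simp
    next
      case False
      have "norm (T x) * norm (T x) \<le> norm x * norm (T x) * K"
        using K[of x "T x"] unfolding T by (simp add: norm_eq_sqrt_inner)
      then show ?thesis using False
        by (metis mult.assoc mult.commute mult_right_le_imp_le zero_less_norm_iff)
    qed
  qed
  then show ?thesis using T by (metis bounded_linear_Blinfun_apply)
qed

lemma blinfun_adjoint_inner:
  fixes A :: "'a::{real_inner,complete_space} \<Rightarrow>\<^sub>L 'a"
  shows "blinfun_adjoint A x \<bullet> y = x \<bullet> A y"
proof -
  have "bounded_bilinear (\<lambda>x y. x \<bullet> A y)"
    using bounded_bilinear.comp[OF bounded_bilinear_inner bounded_linear_ident blinfun.bounded_linear_right] .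
  from blinfun_of_bounded_form[OF this]
  obtain C :: "'a \<Rightarrow>\<^sub>L 'a" where C: "\<And>x y. C x \<bullet> y = x \<bullet> A y" by blast
  then have "\<forall>x y. A x \<bullet> y = x \<bullet> C y" by (metis inner_commute)
  then have "adjoint (blinfun_apply A) = blinfun_apply C" by (rule adjoint_unique)
  then show ?thesis using C by (simp add: blinfun_adjoint_def blinfun_apply_inverse)
qed

lemma selfadjoint_op_iff:
  fixes A :: "'a::{real_inner,complete_space} \<Rightarrow>\<^sub>L 'a"
  shows "selfadjoint_op A \<longleftrightarrow> (\<forall>x y. A x \<bullet> y = x \<bullet> A y)"
proof
  assume "\<forall>x y. A x \<bullet> y = x \<bullet> A y"
  then have "blinfun_adjoint A x = A x" for x
    using blinfun_adjoint_inner[of A x] by (intro vector_eq_rdot[THEN iffD1]) simp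
  then show "selfadjoint_op A" by (simp add: selfadjoint_op_def blinfun_eqI)
qed (metis blinfun_adjoint_inner selfadjoint_op_def)

section \<open>Nonnegative operators\<close>

lemma nonneg_op_iff:
  "nonneg_op A \<longleftrightarrow> (\<forall>x y. A x \<bullet> y = x \<bullet> A y) \<and> (\<forall>x. 0 \<le> A x \<bullet> x)"
  by (simp add: nonneg_op_def selfadjoint_op_iff)

lemma nonneg_op_symmetric: "nonneg_op A \<Longrightarrow> A x \<bullet> y = A y \<bullet> x"
  by (metis nonneg_op_iff inner_commute)

lemma nonneg_op_ge0: "nonneg_op A \<Longrightarrow> 0 \<le> A x \<bullet> x"
  by (simp add: nonneg_op_def)

text \<open>
  \<open>\<langle>A x, y\<rangle>\<close> is a semi-inner product, so the discriminant of \<open>t \<mapsto> \<langle>A (x + t y), x + t y\<rangle>\<close> is nonpositive.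
\<close>

lemma nonneg_op_cauchy_schwarz:
  assumes A: "nonneg_op A"
  shows "(A x \<bullet> y)\<^sup>2 \<le> (A x \<bullet> x) * (A y \<bullet> y)"
proof -
  have quad: "0 \<le> A x \<bullet> x + 2 * t * (A x \<bullet> y) + t\<^sup>2 * (A y \<bullet> y)" for t
    using nonneg_op_ge0[OF A, of "x + t *\<^sub>R y"] nonneg_op_symmetric[OF A, of y x]
    by (simp add: blinfun.bilinear_simps inner_simps algebra_simps power2_eq_square)
  show ?thesis
  proof (cases "A y \<bullet> y = 0")
    case True
    have "A x \<bullet> y = 0"
    proof (rule ccontr)
      assume "A x \<bullet> y \<noteq> 0"
      then show False 
        \<comment> \<open>If \<open>\<langle>A y, y\<rangle> = 0\<close>, the quadratic is affine in \<open>t\<close>; at this \<open>t\<close> it takes the value \<open>-1\<close>.\<close>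
        using quad[of "- (A x \<bullet> x + 1) / (2 * (A x \<bullet> y))"] True by (simp add: field_simps)
    qed
    then show ?thesis using True by simp
  next
    case False
    then have pos: "A y \<bullet> y > 0" using nonneg_op_ge0[OF A, of y] by linarith
    then show ?thesis using quad[of "- (A x \<bullet> y) / (A y \<bullet> y)"]
      by (simp add: field_simps power2_eq_square)
  qed
qed

text \<open>
  Cauchy-Schwarz for the semi-inner product \<open>\<langle>A x, y\<rangle>\<close> with \<open>y = A x\<close>.  Smallness of the quadratic form
  at \<open>x\<close> thus forces smallness of \<open>A x\<close>.
\<close>

lemma nonneg_op_norm_square_le:
  assumes A: "nonneg_op A"
  shows "(norm (A x))\<^sup>2 \<le> norm A * (A x \<bullet> x)"
proof (cases "A x = 0")
  case False
  have "((norm (A x))\<^sup>2)\<^sup>2 \<le> (A x \<bullet> x) * (A (A x) \<bullet> A x)"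
    using nonneg_op_cauchy_schwarz[OF A, of x "A x"] by (simp add: power2_norm_eq_inner)
  also have "\<dots> \<le> (A x \<bullet> x) * (norm A * norm (A x) * norm (A x))"
    by (intro mult_left_mono order_trans[OF norm_cauchy_schwarz] mult_right_mono norm_blinfun
        norm_ge_zero nonneg_op_ge0[OF A])
  finally have "(norm (A x))\<^sup>2 * (norm (A x))\<^sup>2 \<le> (norm A * (A x \<bullet> x)) * (norm (A x))\<^sup>2"
    by (simp add: power2_eq_square mult_ac)
  moreover have "0 < (norm (A x))\<^sup>2" using False by simp
  ultimately show ?thesis by (rule mult_right_le_imp_le)
qed (use nonneg_op_ge0[OF A, of x] in simp)

text \<open>
  The infimum \<open>m\<close> of the quadratic form over the unit sphere lies in the spectrum.  Indeed \<open>T = A - m\<close>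
  is nonnegative, and a bounded left inverse of \<open>T\<close> would bound \<open>\<parallel>T u\<parallel>\<close>, hence by
  \<open>\<parallel>T u\<parallel>\<^sup>2 \<le> \<parallel>T\<parallel> \<langle>T u, u\<rangle>\<close> also the form of \<open>T\<close>, away from zero on the sphere.
\<close>

lemma spectrum_nonneg_imp_form_nonneg:
  assumes sa: "selfadjoint_op A" and sp: "spectrum_op A \<subseteq> {0..}"
  shows "0 \<le> A x \<bullet> x"
proof (rule ccontr)
  assume neg: "\<not> 0 \<le> A x \<bullet> x"
  define Q where "Q = (\<lambda>u. A u \<bullet> u) ` sphere 0 1"
  have bdd: "bdd_below Q"
  proof (rule bdd_belowI2[where m = "- norm A" and f="\<lambda>u. A u \<bullet> u" and A="sphere 0 1", folded Q_def])
    fix u :: 'a assume "u \<in> sphere 0 1"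
    then have "\<bar>A u \<bullet> u\<bar> \<le> norm A"
      using Cauchy_Schwarz_ineq2[of "A u" u] norm_blinfun[of A u] by simp
    then show "- norm A \<le> A u \<bullet> u" by linarith
  qed
  have x0: "x \<noteq> 0" using neg by auto
  have sgnx: "sgn x \<in> sphere 0 1" using x0 by (simp add: norm_sgn)
  have "A (sgn x) \<bullet> sgn x = (A x \<bullet> x) / (norm x)\<^sup>2"
    by (simp add: sgn_div_norm blinfun.bilinear_simps power2_eq_square field_simps)
  also have "\<dots> < 0" using neg x0 by (simp add: divide_less_0_iff not_le)
  finally have "A (sgn x) \<bullet> sgn x < 0" .
  define m where "m = Inf Q"
  have m_le: "m \<le> A u \<bullet> u" if "norm u = 1" for u
    unfolding m_def using that by (intro cInf_lower[OF _ bdd]) (auto simp: Q_def)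
  have "m < 0" using m_le[of "sgn x"] \<open>A (sgn x) \<bullet> sgn x < 0\<close> sgnx by simp
  then have "m \<notin> spectrum_op A" using sp by auto
  define T where "T = A - m *\<^sub>R id_blinfun"
  obtain C where C: "C o\<^sub>L T = id_blinfun"
    using \<open>m \<notin> spectrum_op A\<close> by (auto simp: spectrum_op_def T_def)
  have T_form: "T u \<bullet> u = A u \<bullet> u - m * (u \<bullet> u)" for u
    by (simp add: T_def blinfun.bilinear_simps inner_simps)
  have T: "nonneg_op T"
    unfolding nonneg_op_iff
  proof (intro conjI allI)
    show "T x \<bullet> y = x \<bullet> T y" for x y
      using sa by (simp add: T_def blinfun.bilinear_simps inner_simps selfadjoint_op_iff)
    show "0 \<le> T u \<bullet> u" for u
    proof (cases "u = 0")
      case False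
      have "m \<le> A (sgn u) \<bullet> sgn u" using False by (intro m_le) (simp add: norm_sgn)
      also have "\<dots> = (A u \<bullet> u) / (norm u)\<^sup>2"
        by (simp add: sgn_div_norm blinfun.bilinear_simps power2_eq_square field_simps)
      finally show ?thesis using False by (simp add: T_form field_simps power2_norm_eq_inner)
    qed simp
  qed
  define d where "d = inverse ((norm C)\<^sup>2 * norm T)"
  have CT: "C (T u) = u" for u by (metis C blinfun_apply_blinfun_compose blinfun_apply_id_blinfun id_apply)
  have lower: "d \<le> T u \<bullet> u" and pos: "0 < (norm C)\<^sup>2 * norm T" if "norm u = 1" for u
  proof -
    have "1 \<le> norm C * norm (T u)" using norm_blinfun[of C "T u"] that by (simp add: CT)
    then have "1 \<le> (norm C * norm (T u))\<^sup>2" by (simp add: one_le_power)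
    also have "\<dots> \<le> (norm C)\<^sup>2 * (norm T * (T u \<bullet> u))"
      using nonneg_op_norm_square_le[OF T, of u] by (simp add: power_mult_distrib mult_left_mono)
    finally have *: "1 \<le> ((norm C)\<^sup>2 * norm T) * (T u \<bullet> u)" by (simp add: mult_ac)
    moreover have "0 \<le> (norm C)\<^sup>2 * norm T" by simp
    ultimately show "0 < (norm C)\<^sup>2 * norm T" by (metis less_eq_real_def mult_zero_left not_one_le_zero)
    then show "d \<le> T u \<bullet> u" using * unfolding d_def by (simp add: field_simps)
  qed
  have "norm (sgn x) = 1" using sgnx by simp
  then have "0 < d" using pos unfolding d_def by (simp add: zero_less_mult_iff)
  have "m + d \<le> Inf Q"
  proof (rule cInf_greatest)
    show "Q \<noteq> {}" using sgnx by (auto simp: Q_def)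
    fix q assume "q \<in> Q"
    then obtain u where "norm u = 1" "q = A u \<bullet> u" by (auto simp: Q_def)
    then show "m + d \<le> q" using lower[of u] by (simp add: T_form norm_eq_1)
  qed
  then show False using \<open>0 < d\<close> by (simp add: m_def)
qed

text \<open>
  The equation is the fixed point equation of \<open>x \<mapsto> x - t (A x + c x - y)\<close>.  With
  \<open>t = 1 / (\<parallel>A\<parallel> + c)\<close> the linear part \<open>S = (1 - t c) I - t A\<close> satisfies
  \<open>\<parallel>S\<parallel> \<le> 1 - t c < 1\<close>, because \<open>0 \<le> t A \<le> (1 - t c) I\<close>, so this map is a contraction.
\<close>

lemma nonneg_op_shift_surj:
  assumes A: "nonneg_op A" and c: "0 < c"
  shows "\<exists>x. A x + c *\<^sub>R x = y"
proof -
  define t where "t = inverse (norm A + c)"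
  define k where "k = 1 - t * c"
  have t: "0 < t" using c by (simp add: t_def add_nonneg_pos)
  have tA: "t * (norm A + c) = 1" using c by (simp add: t_def add_nonneg_pos less_imp_neq[symmetric])
  have k: "0 \<le> k" "k < 1" 
  proof -
    have "t * norm A + t * c = 1" "0 \<le> t * norm A" "0 < t * c"
      using tA t c by (auto simp: distrib_left)
    then show "0 \<le> k" "k < 1" by (auto simp: k_def)
  qed
  define S where "S = k *\<^sub>R id_blinfun - t *\<^sub>R A"
  have kt: "k = t * norm A" using tA by (simp add: k_def algebra_simps)
  have nS: "norm S \<le> k"
  proof (rule norm_blinfun_bound[OF k(1)])
    fix x
    have Ax: "(norm (A x))\<^sup>2 \<le> norm A * (A x \<bullet> x)" by (rule nonneg_op_norm_square_le[OF A])
    have "(norm (S x))\<^sup>2 = k\<^sup>2 * (x \<bullet> x) - 2 * k * t * (A x \<bullet> x) + t\<^sup>2 * (norm (A x))\<^sup>2"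
      unfolding power2_norm_eq_inner
      by (simp add: S_def blinfun.bilinear_simps inner_simps inner_commute power2_eq_square algebra_simps)
    also have "\<dots> \<le> k\<^sup>2 * (x \<bullet> x) - 2 * k * t * (A x \<bullet> x) + t\<^sup>2 * (norm A * (A x \<bullet> x))"
      using Ax by (simp add: mult_left_mono)
    also have "\<dots> = k\<^sup>2 * (x \<bullet> x) - k * t * (A x \<bullet> x)"
      by (simp add: kt power2_eq_square algebra_simps)
    also have "\<dots> \<le> (k * norm x)\<^sup>2"
      using k t nonneg_op_ge0[OF A, of x] by (simp add: power_mult_distrib power2_norm_eq_inner)
    finally show "norm (S x) \<le> k * norm x"
      by (rule power2_le_imp_le) (use k in simp)
  qed
  define F where "F x = S x + t *\<^sub>R y" for x
  have "dist (F u) (F v) \<le> k * dist u v" for u v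
  proof -
    have "dist (F u) (F v) = norm (S (u - v))" by (simp add: F_def dist_norm blinfun.diff_right)
    also have "\<dots> \<le> k * norm (u - v)"
      using norm_blinfun[of S "u - v"] nS by (meson mult_right_mono norm_ge_zero order_trans)
    finally show ?thesis by (simp add: dist_norm)
  qed
  then obtain x where x: "F x = x" using banach_fix_type[OF k, of F] by blast
  have "x = x - (t * c) *\<^sub>R x - t *\<^sub>R A x + t *\<^sub>R y"
    using x by (simp add: F_def S_def k_def blinfun.bilinear_simps algebra_simps)
  then have "t *\<^sub>R (A x + c *\<^sub>R x) = t *\<^sub>R y" by (simp add: algebra_simps)
  then show ?thesis using t by auto
qed

text \<open>
  For \<open>l = - c < 0\<close> the operator \<open>A - l\<close> is onto, and \<open>\<langle>(A + c) x, x\<rangle> \<ge> c \<parallel>x\<parallel>\<^sup>2\<close> makes its inverse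
  well-defined and bounded.
\<close>

lemma nonneg_op_spectrum:
  assumes A: "nonneg_op A"
  shows "spectrum_op A \<subseteq> {0..}"
proof (rule subsetI, rule ccontr)
  fix l assume l: "l \<in> spectrum_op A" and "l \<notin> {0..}"
  define c where "c = - l"
  have c: "0 < c" using \<open>l \<notin> {0..}\<close> by (simp add: c_def)
  define T where "T = A - l *\<^sub>R id_blinfun"
  have T: "T x = A x + c *\<^sub>R x" for x by (simp add: T_def c_def blinfun.bilinear_simps)
  have low: "c * norm x \<le> norm (T x)" for x
  proof (cases "x = 0")
    case False
    have "c * norm x * norm x \<le> T x \<bullet> x"
      using nonneg_op_ge0[OF A, of x] by (simp add: T inner_simps dot_square_norm power2_eq_square)
    also have "\<dots> \<le> norm (T x) * norm x" by (rule norm_cauchy_schwarz)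
    finally show ?thesis using False by simp
  qed simp
  have inj: "x = y" if "T x = T y" for x y
    using low[of "x - y"] that c by (simp add: blinfun.diff_right mult_le_0_iff)
  obtain D where D: "\<And>y. T (D y) = y"
    using nonneg_op_shift_surj[OF A c] T by metis
  have "bounded_linear D"
  proof (rule bounded_linear_intro[where K = "inverse c"])
    show "D (x + y) = D x + D y" for x y by (rule inj) (simp add: D blinfun.add_right)
    show "D (r *\<^sub>R x) = r *\<^sub>R D x" for r x by (rule inj) (simp add: D blinfun.scaleR_right)
    show "norm (D x) \<le> norm x * inverse c" for x
      using low[of "D x"] c by (simp add: D field_simps)
  qed
  then have DA: "blinfun_apply (Blinfun D) = D" by (rule bounded_linear_Blinfun_apply)
  have "Blinfun D o\<^sub>L T = id_blinfun"
    by (rule blinfun_eqI) (simp add: DA inj D)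
  moreover have "T o\<^sub>L Blinfun D = id_blinfun"
    by (rule blinfun_eqI) (simp add: DA D)
  ultimately have "\<exists>C. C o\<^sub>L T = id_blinfun \<and> T o\<^sub>L C = id_blinfun" by blast
  then show False using l by (auto simp: spectrum_op_def T_def)
qed

lemma selfadjoint_spectrum_nonneg_iff:
  "selfadjoint_op A \<and> spectrum_op A \<subseteq> {0..} \<longleftrightarrow> nonneg_op A"
  using nonneg_op_spectrum spectrum_nonneg_imp_form_nonneg nonneg_op_def by metis


lemma norm_blinfun_approximable:
  fixes D :: "'a::real_normed_vector \<Rightarrow>\<^sub>L 'b::real_normed_vector"
  shows "\<exists>X. (\<forall>n::nat. norm (X n) \<le> 1) \<and> (\<lambda>n. norm (D (X n))) \<longlonglongrightarrow> norm D"
proof -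
  have "\<exists>x. norm x \<le> 1 \<and> norm D - inverse (real (Suc n)) < norm (D x)" for n
  proof (rule ccontr)
    define b where "b = norm D - inverse (real (Suc n))"
    assume "\<not> ?thesis"
    then have *: "norm (D x) \<le> b" if "norm x \<le> 1" for x using that by (auto simp: b_def not_less)
    have "norm D \<le> b"
    proof (rule norm_blinfun_bound)
      show "0 \<le> b" using *[of 0] by simp
      fix x
      have "norm (D (sgn x)) \<le> b" by (rule *) (simp add: norm_sgn)
      then show "norm (D x) \<le> b * norm x"
        by (cases "x = 0") (simp_all add: sgn_div_norm blinfun.scaleR_right field_simps)
    qed
    then show False by (simp add: b_def)
  qed
  then obtain X where X: "\<And>n. norm (X n) \<le> 1" "\<And>n. norm D - inverse (real (Suc n)) < norm (D (X n))"
    by metis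
  have "(\<lambda>n. norm D - inverse (real (Suc n))) \<longlonglongrightarrow> norm D - 0"
    by (intro tendsto_intros LIMSEQ_inverse_real_of_nat)
  then have lim: "(\<lambda>n. norm D - inverse (real (Suc n))) \<longlonglongrightarrow> norm D" by simp
  have up: "norm (D (X n)) \<le> norm D" for n
    using norm_blinfun[of D "X n"] mult_left_mono[OF X(1)[of n], of "norm D"] by simp
  have "(\<lambda>n. norm (D (X n))) \<longlonglongrightarrow> norm D"
    by (rule tendsto_sandwich[OF _ _ lim tendsto_const])
       (use X(2) up in \<open>auto intro!: always_eventually less_imp_le\<close>)
  then show ?thesis using X(1) by blast
qed

text \<open>
  Put \<open>D = P - A\<close> and \<open>S = P + A\<close>; from \<open>P\<^sup>2 = A\<^sup>2\<close> follows \<open>S D = - D S\<close>.  Let \<open>x\<close> be a unit vector with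
  \<open>\<parallel>D x\<parallel>\<close> close to \<open>M = \<parallel>D\<parallel>\<close>.  Then \<open>D\<^sup>2 x\<close> is close to \<open>M\<^sup>2 x\<close>, and anticommutation gives
  \<open>\<langle>S D x, D x\<rangle> = - \<langle>S x, D\<^sup>2 x\<rangle>\<close>, so the nonnegative quantity \<open>\<langle>S D x, D x\<rangle> + M\<^sup>2 \<langle>S x, x\<rangle>\<close> is
  small.  If \<open>M > 0\<close>, then \<open>\<langle>P x, x\<rangle>\<close> and \<open>\<langle>A x, x\<rangle>\<close> are small, hence so are \<open>P x\<close>, \<open>A x\<close> and
  \<open>D x\<close>, which contradicts \<open>\<parallel>D x\<parallel> \<approx> M\<close>.  The estimate \<open>key\<close> is the quantitative form of this argument.
\<close>

lemma nonneg_op_sqrt_unique: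
  assumes P: "nonneg_op P" and A: "nonneg_op A" and sq: "P o\<^sub>L P = A o\<^sub>L A"
  shows "P = A"
proof -
  have sq': "P (P x) = A (A x)" for x by (metis sq blinfun_apply_blinfun_compose)
  define D S where "D = P - A" and "S = P + A"
  define M c where "M = norm D" and "c = norm P + norm A"
  have D_sym: "D x \<bullet> y = x \<bullet> D y" and S_sym: "S x \<bullet> y = x \<bullet> S y" for x y
    using P A by (auto simp: D_def S_def nonneg_op_iff blinfun.bilinear_simps inner_simps)
  have S_form: "S x \<bullet> x = P x \<bullet> x + A x \<bullet> x" for x
    by (simp add: S_def blinfun.bilinear_simps inner_simps)
  have anti: "S (D x) = - D (S x)" for x
    by (simp add: D_def S_def blinfun.bilinear_simps sq')
  have key: "M^4 * ((norm (D x))\<^sup>2)\<^sup>2 \<le> 4 * c\<^sup>2 * (norm S)\<^sup>2 * M\<^sup>2 * (M\<^sup>2 - (norm (D x))\<^sup>2)"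
    if x: "norm x \<le> 1" for x
  proof -
    define y where "y = D (D x)"
    have Sx: "norm (S x) \<le> norm S"
      using norm_blinfun[of S x] mult_left_mono[OF x, of "norm S"] by simp
    have "S x \<bullet> y = - (S (D x) \<bullet> D x)"
      using D_sym[of "S x" "D x"] by (simp add: y_def anti)
    then have neg: "S x \<bullet> y \<le> 0"
      using S_form[of "D x"] nonneg_op_ge0[OF P, of "D x"] nonneg_op_ge0[OF A, of "D x"] by linarith
    have ny: "(norm y)\<^sup>2 \<le> M\<^sup>2 * (norm (D x))\<^sup>2"
      unfolding power_mult_distrib[symmetric] M_def y_def by (intro power_mono norm_blinfun norm_ge_zero)
    have yx: "y \<bullet> x = (norm (D x))\<^sup>2" by (simp add: y_def D_sym power2_norm_eq_inner)
    have nx: "(norm x)\<^sup>2 \<le> 1" using x by (simp add: power_le_one)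
    have "(norm (M\<^sup>2 *\<^sub>R x - y))\<^sup>2 = M^4 * (norm x)\<^sup>2 - 2 * M\<^sup>2 * (y \<bullet> x) + (norm y)\<^sup>2"
      unfolding power2_norm_eq_inner by (simp add: inner_simps inner_commute algebra_simps)
    also have "\<dots> \<le> M^4 * 1 - 2 * M\<^sup>2 * (norm (D x))\<^sup>2 + M\<^sup>2 * (norm (D x))\<^sup>2"
      unfolding yx using ny nx by (intro add_mono diff_mono mult_left_mono) auto
    finally have nd: "(norm (M\<^sup>2 *\<^sub>R x - y))\<^sup>2 \<le> M\<^sup>2 * (M\<^sup>2 - (norm (D x))\<^sup>2)"
      by (simp add: algebra_simps)
    have "M\<^sup>2 * (S x \<bullet> x) \<le> S x \<bullet> (M\<^sup>2 *\<^sub>R x - y)"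
      using neg by (simp add: inner_simps)
    also have "\<dots> \<le> norm (S x) * norm (M\<^sup>2 *\<^sub>R x - y)" by (rule norm_cauchy_schwarz)
    also have "\<dots> \<le> norm S * norm (M\<^sup>2 *\<^sub>R x - y)" by (rule mult_right_mono[OF Sx]) simp
    finally have Sxx: "M\<^sup>2 * (S x \<bullet> x) \<le> norm S * norm (M\<^sup>2 *\<^sub>R x - y)" .
    have "(norm (D x))\<^sup>2 \<le> (norm (P x) + norm (A x))\<^sup>2"
      by (intro power_mono) (auto simp: D_def blinfun.bilinear_simps norm_triangle_ineq4)
    also have "\<dots> \<le> 2 * ((norm (P x))\<^sup>2 + (norm (A x))\<^sup>2)"
      using sum_squares_bound[of "norm (P x)" "norm (A x)"] by (simp add: power2_sum)
    also have "\<dots> \<le> 2 * (c * (P x \<bullet> x) + c * (A x \<bullet> x))"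
      unfolding c_def using nonneg_op_ge0[OF P, of x] nonneg_op_ge0[OF A, of x]
      by (intro mult_left_mono add_mono order_trans[OF nonneg_op_norm_square_le[OF P]]
            order_trans[OF nonneg_op_norm_square_le[OF A]] mult_right_mono) auto
    also have "\<dots> = 2 * c * (S x \<bullet> x)" by (simp add: S_form algebra_simps)
    finally have Dx: "(norm (D x))\<^sup>2 \<le> 2 * c * (S x \<bullet> x)" .
    have "0 \<le> c" by (simp add: c_def)
    have "M\<^sup>2 * (norm (D x))\<^sup>2 \<le> M\<^sup>2 * (2 * c * (S x \<bullet> x))"
      by (rule mult_left_mono[OF Dx]) simp
    also have "\<dots> = 2 * c * (M\<^sup>2 * (S x \<bullet> x))" by simp
    also have "\<dots> \<le> 2 * c * (norm S * norm (M\<^sup>2 *\<^sub>R x - y))"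
      using \<open>0 \<le> c\<close> by (intro mult_left_mono[OF Sxx]) simp
    finally have "(M\<^sup>2 * (norm (D x))\<^sup>2)\<^sup>2 \<le> (2 * c * (norm S * norm (M\<^sup>2 *\<^sub>R x - y)))\<^sup>2"
      by (intro power_mono) auto
    also have "\<dots> = 4 * c\<^sup>2 * (norm S)\<^sup>2 * (norm (M\<^sup>2 *\<^sub>R x - y))\<^sup>2"
      by (simp add: power_mult_distrib)
    also have "\<dots> \<le> 4 * c\<^sup>2 * (norm S)\<^sup>2 * (M\<^sup>2 * (M\<^sup>2 - (norm (D x))\<^sup>2))"
      by (rule mult_left_mono[OF nd]) simp
    finally show ?thesis by (simp add: power_mult_distrib mult.assoc)
  qed
  obtain X where X: "\<And>n::nat. norm (X n) \<le> 1" and lim: "(\<lambda>n. norm (D (X n))) \<longlonglongrightarrow> M"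
    using norm_blinfun_approximable[of D] unfolding M_def by blast
  have "(\<lambda>n. M^4 * ((norm (D (X n)))\<^sup>2)\<^sup>2) \<longlonglongrightarrow> M^4 * (M\<^sup>2)\<^sup>2"
    by (intro tendsto_intros lim)
  moreover have "(\<lambda>n. 4 * c\<^sup>2 * (norm S)\<^sup>2 * M\<^sup>2 * (M\<^sup>2 - (norm (D (X n)))\<^sup>2))
      \<longlonglongrightarrow> 4 * c\<^sup>2 * (norm S)\<^sup>2 * M\<^sup>2 * (M\<^sup>2 - M\<^sup>2)"
    by (intro tendsto_intros lim)
  ultimately have "M^4 * (M\<^sup>2)\<^sup>2 \<le> 4 * c\<^sup>2 * (norm S)\<^sup>2 * M\<^sup>2 * (M\<^sup>2 - M\<^sup>2)"
    by (rule LIMSEQ_le) (intro exI allI impI key X)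
  then have "M ^ 4 * (M\<^sup>2)\<^sup>2 \<le> 0" by simp
  moreover have "0 \<le> M" by (simp add: M_def)
  ultimately have "M = 0" by (simp add: mult_le_0_iff)
  then show ?thesis by (simp add: M_def D_def)
qed

text \<open>
  The definite description of the modulus is resolved for nonnegative operators by uniqueness of
  square roots; existence is trivial there since \<open>A\<close> is a root of \<open>A\<^sup>* A = A\<^sup>2\<close>.
\<close>

lemma abs_op_nonneg:
  assumes A: "nonneg_op A"
  shows "abs_op A = A"
proof -
  have "blinfun_adjoint A = A" using A by (simp add: nonneg_op_def selfadjoint_op_def)
  then show ?thesis
    unfolding abs_op_def using A nonneg_op_sqrt_unique[OF _ A] by (intro the_equality) auto
qed

section \<open>Orthonormal bases\<close>

definition proj_onto :: "'a::real_inner set \<Rightarrow> 'a \<Rightarrow> 'a" where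
  "proj_onto F x = (\<Sum>f\<in>F. (x \<bullet> f) *\<^sub>R f)"

lemma onb_inner:
  assumes "is_onb E" "e \<in> E" "f \<in> E"
  shows "e \<bullet> f = (if e = f then 1 else 0)"
  using assms by (auto simp: is_onb_def pairwise_def orthogonal_def norm_eq_1)

lemma proj_onto_inner:
  assumes E: "is_onb E" and F: "finite F" "F \<subseteq> E" and f: "f \<in> F"
  shows "proj_onto F x \<bullet> f = x \<bullet> f"
proof -
  have "proj_onto F x \<bullet> f = (\<Sum>e\<in>F. (x \<bullet> e) * (if e = f then 1 else 0))"
    unfolding proj_onto_def inner_sum_left
    by (rule sum.cong) (use F f in \<open>auto simp: onb_inner[OF E] subset_iff\<close>)
  also have "\<dots> = x \<bullet> f" using F f by (simp add: if_distrib cong: if_cong)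
  finally show ?thesis .
qed

lemma proj_onto_best_approximation:
  assumes E: "is_onb E" and F: "finite F" "F \<subseteq> E" and s: "s \<in> span F"
  shows "norm (x - proj_onto F x) \<le> norm (x - s)"
proof -
  define p where "p = proj_onto F x"
  \<comment> \<open>\<open>x - p\<close> is orthogonal to \<open>span F\<close>, so Pythagoras applies to \<open>x - s = (x - p) + (p - s)\<close>.\<close>
  have "p \<in> span F" unfolding p_def proj_onto_def by (intro span_sum span_scale span_base)
  then have ps: "p - s \<in> span F" using s by (rule span_diff)
  have "orthogonal (x - p) (p - s)"
  proof (rule orthogonal_to_span[OF ps])
    fix f assume "f \<in> F"
    then show "orthogonal (x - p) f"
      unfolding orthogonal_def p_def by (simp add: inner_diff_left proj_onto_inner[OF E F])
  qed
  then have "(norm (x - p))\<^sup>2 \<le> (norm ((x - p) + (p - s)))\<^sup>2"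
    by (subst norm_add_Pythagorean) auto
  then have "(norm (x - p))\<^sup>2 \<le> (norm (x - s))\<^sup>2" by simp
  then show ?thesis unfolding p_def by (rule power2_le_imp_le) simp
qed

text \<open>
  Density of the span gives an approximation of \<open>x\<close> in the span of a finite subset, and orthogonal
  projections onto larger spans are only closer to \<open>x\<close>.
\<close>

lemma onb_approximation:
  assumes E: "is_onb E" and e: "0 < \<epsilon>"
  shows "\<exists>F0. finite F0 \<and> F0 \<subseteq> E \<and>
    (\<forall>F. finite F \<and> F0 \<subseteq> F \<and> F \<subseteq> E \<longrightarrow> norm (x - proj_onto F x) < \<epsilon>)"
proof -
  have "x \<in> closure (span E)" using E by (simp add: is_onb_def)
  then obtain s where s: "s \<in> span E" "dist s x < \<epsilon>" using e by (meson closure_approachable)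
  then obtain F0 c where F0: "finite F0" "F0 \<subseteq> E" and "s = (\<Sum>a\<in>F0. c a *\<^sub>R a)"
    unfolding span_explicit by blast
  then have sF0: "s \<in> span F0" by (simp add: span_sum span_scale span_base)
  have "norm (x - proj_onto F x) < \<epsilon>" if "finite F" "F0 \<subseteq> F" "F \<subseteq> E" for F
  proof -
    have "s \<in> span F" using sF0 that span_mono by blast
    then have "norm (x - proj_onto F x) \<le> norm (x - s)"
      by (rule proj_onto_best_approximation[OF E that(1,3)])
    then show ?thesis using s(2) by (simp add: dist_norm norm_minus_commute)
  qed
  then show ?thesis using F0 by blast
qed

lemma parseval:
  assumes E: "is_onb E"
  shows "((\<lambda>e. (x \<bullet> e) * (y \<bullet> e)) has_sum (x \<bullet> y)) E"
  unfolding has_sum_def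
proof (rule tendstoI)
  fix \<epsilon> :: real assume e: "0 < \<epsilon>"
  define r where "r = \<epsilon> / (norm y + 1)"
  have y1: "0 < norm y + 1" by (simp add: add_nonneg_pos)
  have r: "0 < r" using e y1 by (simp add: r_def)
  from onb_approximation[OF E r, of x]
  obtain F0 where F0: "finite F0" "F0 \<subseteq> E"
    and close: "\<forall>F. finite F \<and> F0 \<subseteq> F \<and> F \<subseteq> E \<longrightarrow> norm (x - proj_onto F x) < r"
    by (elim exE conjE)
  have "dist (\<Sum>e\<in>F. (x \<bullet> e) * (y \<bullet> e)) (x \<bullet> y) < \<epsilon>" if "finite F" "F0 \<subseteq> F" "F \<subseteq> E" for F
  proof -
    have "(\<Sum>e\<in>F. (x \<bullet> e) * (y \<bullet> e)) = proj_onto F x \<bullet> y"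
      by (simp add: proj_onto_def inner_sum_left inner_commute[of y])
    then have "dist (\<Sum>e\<in>F. (x \<bullet> e) * (y \<bullet> e)) (x \<bullet> y) = \<bar>(x - proj_onto F x) \<bullet> y\<bar>"
      by (simp add: dist_real_def inner_diff_left abs_minus_commute)
    also have "\<dots> \<le> norm (x - proj_onto F x) * norm y" by (rule Cauchy_Schwarz_ineq2)
    also have "\<dots> \<le> r * norm y" using close that by (intro mult_right_mono) auto
    also have "\<dots> < r * (norm y + 1)" using r by simp
    also have "\<dots> = \<epsilon>" using y1 by (simp add: r_def)
    finally show ?thesis .
  qed
  then show "\<forall>\<^sub>F F in finite_subsets_at_top E. dist (\<Sum>e\<in>F. (x \<bullet> e) * (y \<bullet> e)) (x \<bullet> y) < \<epsilon>"
    unfolding eventually_finite_subsets_at_top using F0 by blast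
qed

lemma parseval_norm:
  assumes E: "is_onb E"
  shows "((\<lambda>e. (x \<bullet> e)\<^sup>2) has_sum (norm x)\<^sup>2) E"
  using parseval[OF E, of x x] by (simp add: power2_eq_square dot_square_norm)

lemma bessel:
  assumes E: "is_onb E" and F: "finite F" "F \<subseteq> E"
  shows "(\<Sum>f\<in>F. (x \<bullet> f)\<^sup>2) \<le> (norm x)\<^sup>2"
  by (rule has_sum_mono2[OF has_sum_finite[OF F(1)] parseval_norm[OF E] F(2)]) simp

lemma separable_dense_sequence:
  assumes "separable_space (euclidean :: 'a::topological_space topology)"
  shows "\<exists>d :: nat \<Rightarrow> 'a. closure (range d) = UNIV"
proof -
  obtain C :: "'a set" where C: "countable C" "closure C = UNIV"
    using assms by (auto simp: separable_space_def)
  then have "C \<noteq> {}" by auto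
  then show ?thesis using C range_from_nat_into by metis
qed

text \<open>
  A vector in the span of its predecessors yields zero.  Its coefficients in the later sums are then
  \<open>0 / 0 = 0\<close>, so it drops out by itself.
\<close>

function gram_schmidt :: "(nat \<Rightarrow> 'a::real_inner) \<Rightarrow> nat \<Rightarrow> 'a" where
  "gram_schmidt d n = d n - (\<Sum>i<n. ((d n \<bullet> gram_schmidt d i) /
     (gram_schmidt d i \<bullet> gram_schmidt d i)) *\<^sub>R gram_schmidt d i)"
  by auto
termination by (relation "Wellfounded.measure snd") auto

declare gram_schmidt.simps [simp del]

lemma gram_schmidt_orthogonal:
  "i < n \<Longrightarrow> gram_schmidt d i \<bullet> gram_schmidt d n = 0"
proof (induction n arbitrary: i rule: less_induct)
  case (less n)
  let ?g = "gram_schmidt d"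
  have orth: "?g j \<bullet> ?g i = 0" if "j < n" "j \<noteq> i" for j
    using less.IH[of i j] less.IH[of j i] less.prems that by (cases "j < i") (auto simp: inner_commute)
  have "(\<Sum>j<n. ((d n \<bullet> ?g j) / (?g j \<bullet> ?g j)) * (?g j \<bullet> ?g i))
     = (\<Sum>j<n. if j = i then d n \<bullet> ?g i else 0)"
    by (rule sum.cong) (auto simp: orth)
  also have "\<dots> = d n \<bullet> ?g i" using less.prems by simp
  finally show ?case
    by (subst gram_schmidt.simps[of d n])
       (simp add: inner_diff_right inner_sum_right inner_commute)
qed

lemma onb_exists:
  assumes "separable_space (euclidean :: 'a::{real_inner,complete_space} topology)"
  shows "\<exists>E :: 'a set. is_onb E"
proof -
  obtain d :: "nat \<Rightarrow> 'a" where d: "closure (range d) = UNIV"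
    using separable_dense_sequence[OF assms] by blast
  let ?g = "gram_schmidt d"
  define E where "E = (\<lambda>n. sgn (?g n)) ` {n. ?g n \<noteq> 0}"
  have orth: "?g i \<bullet> ?g j = 0" if "i \<noteq> j" for i j
    using that gram_schmidt_orthogonal[of i j d] gram_schmidt_orthogonal[of j i d]
    by (cases "i < j") (auto simp: inner_commute)
  have g_span: "?g n \<in> span E" for n
  proof (cases "?g n = 0")
    case False
    then have "sgn (?g n) \<in> span E" by (intro span_base) (auto simp: E_def)
    then have "norm (?g n) *\<^sub>R sgn (?g n) \<in> span E" by (rule span_scale)
    then show ?thesis using False by (simp add: sgn_div_norm)
  qed (simp add: span_zero)
  have "d n \<in> span E" for n
  proof -
    have "d n = ?g n + (\<Sum>i<n. ((d n \<bullet> ?g i) / (?g i \<bullet> ?g i)) *\<^sub>R ?g i)"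
      by (subst gram_schmidt.simps) simp
    also have "\<dots> \<in> span E" by (intro span_add span_sum span_scale g_span)
    finally show ?thesis .
  qed
  then have "closure (range d) \<subseteq> closure (span E)" by (intro closure_mono) auto
  then have "closure (span E) = UNIV" using d by auto
  moreover have "pairwise orthogonal E"
  proof (rule pairwiseI)
    fix x y assume "x \<in> E" "y \<in> E" "x \<noteq> y"
    then obtain i j where "x = sgn (?g i)" "y = sgn (?g j)" "i \<noteq> j" by (auto simp: E_def)
    then show "orthogonal x y" using orth by (simp add: orthogonal_def sgn_div_norm)
  qed
  moreover have "\<forall>e\<in>E. norm e = 1" by (auto simp: E_def norm_sgn)
  ultimately show ?thesis unfolding is_onb_def by blast
qed

section \<open>Rank one decomposition of nonnegative operators\<close>

definition rank_one_op :: "'a::real_inner \<Rightarrow> 'a \<Rightarrow> 'a \<Rightarrow>\<^sub>L 'a" where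
  "rank_one_op u w = Blinfun (\<lambda>x. (w \<bullet> x) *\<^sub>R u)"

lemma rank_one_op_apply [simp]: "rank_one_op u w x = (w \<bullet> x) *\<^sub>R u"
proof -
  have "bounded_linear (\<lambda>x. (w \<bullet> x) *\<^sub>R u)"
    by (intro bounded_linear_scaleR_left[THEN bounded_linear_compose] bounded_linear_inner_right)
  then show ?thesis by (simp add: rank_one_op_def bounded_linear_Blinfun_apply)
qed

lemma norm_rank_one_op: "norm (rank_one_op u w) \<le> norm u * norm w"
proof (rule norm_blinfun_bound)
  fix x
  show "norm (rank_one_op u w x) \<le> norm u * norm w * norm x"
    using mult_right_mono[OF Cauchy_Schwarz_ineq2[of w x], of "norm u"] by (simp add: mult_ac)
qed simp

text \<open>
  One elimination step of the Cholesky factorisation: subtracting the form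
  \<open>\<langle>R d, x\<rangle> \<langle>R d, y\<rangle> / \<langle>R d, d\<rangle>\<close> turns \<open>d\<close> into a null vector.  If \<open>\<langle>R d, d\<rangle> = 0\<close>, then \<open>R d = 0\<close> already,
  and \<open>inverse 0 = 0\<close> leaves \<open>R\<close> unchanged.
\<close>

primrec cholesky_residual ::
    "('a::{real_inner,complete_space} \<Rightarrow>\<^sub>L 'a) \<Rightarrow> (nat \<Rightarrow> 'a) \<Rightarrow> nat \<Rightarrow> 'a \<Rightarrow>\<^sub>L 'a" where
  "cholesky_residual A d 0 = A"
| "cholesky_residual A d (Suc n) = (let R = cholesky_residual A d n in
     R - inverse (blinfun_apply R (d n) \<bullet> d n) *\<^sub>R rank_one_op (blinfun_apply R (d n)) (blinfun_apply R (d n)))"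

definition cholesky_vector ::
    "('a::{real_inner,complete_space} \<Rightarrow>\<^sub>L 'a) \<Rightarrow> (nat \<Rightarrow> 'a) \<Rightarrow> nat \<Rightarrow> 'a" where
  "cholesky_vector A d n = (let R = cholesky_residual A d n in
     inverse (sqrt (blinfun_apply R (d n) \<bullet> d n)) *\<^sub>R blinfun_apply R (d n))"

lemma cholesky_step:
  assumes "nonneg_op (cholesky_residual A d n)"
  shows "cholesky_residual A d (Suc n) x \<bullet> y =
    cholesky_residual A d n x \<bullet> y - (cholesky_vector A d n \<bullet> x) * (cholesky_vector A d n \<bullet> y)"
proof -
  let ?R = "cholesky_residual A d n"
  have "inverse (sqrt (?R (d n) \<bullet> d n)) * inverse (sqrt (?R (d n) \<bullet> d n)) = inverse (?R (d n) \<bullet> d n)"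
    using nonneg_op_ge0[OF assms, of "d n"] by (simp flip: inverse_mult_distrib real_sqrt_mult)
  then show ?thesis
    by (simp add: Let_def cholesky_vector_def blinfun.bilinear_simps inner_simps algebra_simps)
qed

text \<open>
  Nonnegativity survives an elimination step by the Cauchy-Schwarz inequality for \<open>\<langle>R x, y\<rangle>\<close>.
\<close>

lemma cholesky_residual_nonneg:
  assumes A: "nonneg_op A"
  shows "nonneg_op (cholesky_residual A d n)"
proof (induction n)
  case (Suc n)
  let ?R = "cholesky_residual A d n"
  note step = cholesky_step[OF Suc]
  show ?case
    unfolding nonneg_op_iff
  proof (intro conjI allI)
    show "cholesky_residual A d (Suc n) x \<bullet> y = x \<bullet> cholesky_residual A d (Suc n) y" for x y
      using step[of x y] step[of y x] nonneg_op_symmetric[OF Suc, of x y]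
      by (simp add: inner_commute mult.commute)
    show "0 \<le> cholesky_residual A d (Suc n) x \<bullet> x" for x
    proof (cases "?R (d n) \<bullet> d n = 0")
      case True
      then have "cholesky_residual A d (Suc n) = ?R" by (simp add: Let_def)
      then show ?thesis using nonneg_op_ge0[OF Suc, of x] by (simp only:)
    next
      case False
      then have pos: "0 < ?R (d n) \<bullet> d n" using nonneg_op_ge0[OF Suc, of "d n"] by linarith
      have "(?R (d n) \<bullet> x)\<^sup>2 \<le> (?R (d n) \<bullet> d n) * (?R x \<bullet> x)"
        by (rule nonneg_op_cauchy_schwarz[OF Suc])
      then show ?thesis using pos
        by (simp add: Let_def blinfun.bilinear_simps inner_simps field_simps power2_eq_square)
    qed
  qed
qed (simp add: A)

lemma nonneg_op_zero_if_form_zero: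
  assumes "nonneg_op A" "A x \<bullet> x \<le> 0"
  shows "A x = 0"
proof -
  have "norm A * (A x \<bullet> x) \<le> 0" using assms(2) by (simp add: mult_nonneg_nonpos)
  then have "(norm (A x))\<^sup>2 \<le> 0" using nonneg_op_norm_square_le[OF assms(1), of x] by linarith
  then show ?thesis by simp
qed

lemma cholesky_residual_antimono:
  assumes A: "nonneg_op A"
  shows "cholesky_residual A d (Suc n) x \<bullet> x \<le> cholesky_residual A d n x \<bullet> x"
  by (simp only: cholesky_step[OF cholesky_residual_nonneg[OF A]]) simp

lemma cholesky_residual_le:
  assumes A: "nonneg_op A"
  shows "cholesky_residual A d n x \<bullet> x \<le> A x \<bullet> x"
proof (induction n)
  case (Suc n)
  then show ?case using cholesky_residual_antimono[OF A, of d n x] by linarith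
qed simp

text \<open>
  A step annihilates its own vector, and null vectors remain null since the residuals decrease.
\<close>

lemma cholesky_residual_kills:
  assumes A: "nonneg_op A"
  shows "j < n \<Longrightarrow> cholesky_residual A d n (d j) = 0"
proof (induction n)
  case (Suc n)
  note N = cholesky_residual_nonneg[OF A, of d]
  let ?R = "cholesky_residual A d n"
  have "cholesky_residual A d (Suc n) (d j) \<bullet> d j \<le> 0"
  proof (cases "j = n")
    case True
    show ?thesis
      by (simp add: True Let_def blinfun.bilinear_simps inner_simps field_simps)
  next
    case False
    then have "?R (d j) = 0" using Suc by simp
    then show ?thesis using cholesky_residual_antimono[OF A, of d n "d j"] by simp
  qed
  then show ?case by (rule nonneg_op_zero_if_form_zero[OF N])
qed simp

text \<open>
  If \<open>z = x - d j\<close> is small and \<open>n > j\<close>, then \<open>\<langle>R x, x\<rangle> = \<langle>R z, z\<rangle> \<le> \<langle>A z, z\<rangle>\<close> for the residual \<open>R\<close> of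
  step \<open>n\<close>, because \<open>R (d j) = 0\<close>.
\<close>

lemma cholesky_residual_tendsto_zero:
  assumes A: "nonneg_op A" and d: "closure (range d) = UNIV"
  shows "(\<lambda>n. cholesky_residual A d n x \<bullet> x) \<longlonglongrightarrow> 0"
proof (rule LIMSEQ_I)
  fix \<epsilon> :: real assume e: "0 < \<epsilon>"
  define r where "r = sqrt (\<epsilon> / (norm A + 1))"
  have A1: "0 < norm A + 1" by (simp add: add_nonneg_pos)
  have r: "0 < r" "r\<^sup>2 = \<epsilon> / (norm A + 1)" using e A1 by (simp_all add: r_def)
  have "x \<in> closure (range d)" using d by simp
  then obtain j where j: "dist (d j) x < r" using r(1) by (auto simp: closure_approachable)
  define z where "z = x - d j"
  have "norm z < r" using j by (simp add: z_def dist_norm norm_minus_commute)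
  then have z: "(norm z)\<^sup>2 < \<epsilon> / (norm A + 1)" unfolding r(2)[symmetric] by (intro power_strict_mono) auto
  have "norm (cholesky_residual A d n x \<bullet> x - 0) < \<epsilon>" if n: "n \<ge> Suc j" for n
  proof -
    let ?R = "cholesky_residual A d n"
    have N: "nonneg_op ?R" by (rule cholesky_residual_nonneg[OF A])
    have R0: "?R (d j) = 0" using n by (intro cholesky_residual_kills[OF A]) simp
    have "?R x = ?R z" by (simp add: z_def blinfun.diff_right R0)
    then have "?R x \<bullet> x = ?R x \<bullet> z"
      using nonneg_op_symmetric[OF N, of x "d j"] R0 by (simp add: z_def inner_diff_right)
    then have "?R x \<bullet> x = ?R z \<bullet> z" using \<open>?R x = ?R z\<close> by simp
    also have "\<dots> \<le> A z \<bullet> z" by (rule cholesky_residual_le[OF A])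
    also have "\<dots> \<le> norm A * norm z * norm z"
      by (rule order_trans[OF norm_cauchy_schwarz]) (intro mult_right_mono norm_blinfun norm_ge_zero)
    also have "\<dots> \<le> (norm A + 1) * (norm z)\<^sup>2" by (simp add: power2_eq_square algebra_simps)
    also have "\<dots> < \<epsilon>" using z A1 by (simp add: field_simps)
    finally show ?thesis using nonneg_op_ge0[OF N, of x] by simp
  qed
  then show "\<exists>no. \<forall>n\<ge>no. norm (cholesky_residual A d n x \<bullet> x - 0) < \<epsilon>" by blast
qed

text \<open>
  The infinite Cholesky factorisation \<open>A = \<Sum>\<^sub>k v\<^sub>k \<otimes> v\<^sub>k\<close> along a dense sequence.  It takes the place of the
  operator square root: with \<open>v\<^sub>k\<close> it expresses the trace without reference to a basis.
\<close>

lemma rank_one_decomposition: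
  fixes A :: "'a::{real_inner,complete_space} \<Rightarrow>\<^sub>L 'a"
  assumes sep: "separable_space (euclidean :: 'a topology)" and A: "nonneg_op A"
  shows "\<exists>v :: nat \<Rightarrow> 'a. \<forall>x y. ((\<lambda>k. (v k \<bullet> x) * (v k \<bullet> y)) has_sum (A x \<bullet> y)) UNIV"
proof -
  obtain d :: "nat \<Rightarrow> 'a" where d: "closure (range d) = UNIV"
    using separable_dense_sequence[OF sep] by blast
  define v where "v = cholesky_vector A d"
  have partial: "(\<Sum>k<n. (v k \<bullet> x)\<^sup>2) = A x \<bullet> x - cholesky_residual A d n x \<bullet> x" for n x
    by (induction n)
       (simp_all add: cholesky_step[OF cholesky_residual_nonneg[OF A]] v_def power2_eq_square
          del: cholesky_residual.simps(2))
  have sq: "((\<lambda>k. (v k \<bullet> x)\<^sup>2) has_sum (A x \<bullet> x)) UNIV" for x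
  proof (rule norm_summable_imp_has_sum)
    have "(\<lambda>n. A x \<bullet> x - cholesky_residual A d n x \<bullet> x) \<longlonglongrightarrow> A x \<bullet> x - 0"
      by (intro tendsto_intros cholesky_residual_tendsto_zero[OF A d])
    then show s: "(\<lambda>k. (v k \<bullet> x)\<^sup>2) sums (A x \<bullet> x)"
      by (simp add: sums_def partial)
    then show "summable (\<lambda>k. norm ((v k \<bullet> x)\<^sup>2))" by (simp add: sums_iff)
  qed
  have "((\<lambda>k. (v k \<bullet> x) * (v k \<bullet> y)) has_sum (A x \<bullet> y)) UNIV" for x y
  proof -
    have "((\<lambda>k. (1/4) * ((v k \<bullet> (x + y))\<^sup>2 + - ((v k \<bullet> (x - y))\<^sup>2))) has_sum
        (1/4) * (A (x + y) \<bullet> (x + y) + - (A (x - y) \<bullet> (x - y)))) UNIV"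
      by (intro has_sum_cmult_right has_sum_add has_sum_uminusI sq)
    moreover have "(1/4) * ((v k \<bullet> (x + y))\<^sup>2 + - ((v k \<bullet> (x - y))\<^sup>2)) = (v k \<bullet> x) * (v k \<bullet> y)" for k
      by (simp add: inner_simps power2_eq_square algebra_simps)
    moreover have "(1/4) * (A (x + y) \<bullet> (x + y) + - (A (x - y) \<bullet> (x - y))) = A x \<bullet> y"
      using nonneg_op_symmetric[OF A, of y x]
      by (simp add: blinfun.bilinear_simps inner_simps algebra_simps)
    ultimately show ?thesis by simp
  qed
  then show ?thesis by blast
qed

section \<open>The trace of a nonnegative operator\<close>

text \<open>
  Both sums are iterated sums of the nonnegative double family \<open>\<langle>v\<^sub>k, e\<rangle>\<^sup>2\<close>: summing over \<open>k\<close> first gives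
  \<open>\<langle>A e, e\<rangle>\<close>, summing over \<open>e\<close> first gives \<open>\<parallel>v\<^sub>k\<parallel>\<^sup>2\<close>.
\<close>

lemma summable_square_norms_if_diagonal_summable:
  assumes E: "is_onb E"
    and v: "\<And>x y. ((\<lambda>k. (v k \<bullet> x) * (v k \<bullet> y)) has_sum (A x \<bullet> y)) UNIV"
    and s: "(\<lambda>e. A e \<bullet> e) summable_on E"
  shows "(\<lambda>k. (norm (v k))\<^sup>2) summable_on UNIV"
proof -
  have "(\<lambda>(e, k). (v k \<bullet> e)\<^sup>2) summable_on E \<times> UNIV"
    by (rule summable_on_SigmaI[OF _ s]) (use v in \<open>auto simp: power2_eq_square\<close>)
  then have "(\<lambda>(k, e). (v k \<bullet> e)\<^sup>2) summable_on UNIV \<times> E"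
    by (subst summable_on_swap) (simp add: case_prod_unfold)
  then obtain S where "((\<lambda>(k, e). (v k \<bullet> e)\<^sup>2) has_sum S) (UNIV \<times> E)"
    by (auto simp: summable_on_def)
  then have "((\<lambda>k. (norm (v k))\<^sup>2) has_sum S) UNIV"
    by (rule has_sum_SigmaD) (simp add: parseval_norm[OF E])
  then show ?thesis by (auto simp: summable_on_def)
qed

text \<open>
  Both sums are iterated sums of \<open>\<langle>v\<^sub>k, e\<rangle> \<langle>B\<^sup>* v\<^sub>k, e\<rangle>\<close>.  This double family is absolutely summable since it
  is dominated by \<open>\<langle>v\<^sub>k, e\<rangle>\<^sup>2 + \<langle>B\<^sup>* v\<^sub>k, e\<rangle>\<^sup>2\<close>, whose sum over \<open>e\<close> is \<open>\<parallel>v\<^sub>k\<parallel>\<^sup>2 + \<parallel>B\<^sup>* v\<^sub>k\<parallel>\<^sup>2\<close>.  The sum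
  over \<open>k\<close> does not mention the basis, whence the trace is independent of it.
\<close>

lemma trace_of_product:
  fixes A B :: "'a::{real_inner,complete_space} \<Rightarrow>\<^sub>L 'a"
  assumes E: "is_onb E"
    and v: "\<And>x y. ((\<lambda>k. (v k \<bullet> x) * (v k \<bullet> y)) has_sum (A x \<bullet> y)) UNIV"
    and s: "(\<lambda>k. (norm (v k))\<^sup>2) summable_on UNIV"
  shows "\<exists>S. ((\<lambda>e. A e \<bullet> B e) has_sum S) E \<and> ((\<lambda>k. B (v k) \<bullet> v k) has_sum S) UNIV"
proof -
  define C where "C = blinfun_adjoint B"
  have C: "C x \<bullet> y = x \<bullet> B y" for x y by (simp add: C_def blinfun_adjoint_inner)
  define g where "g = (\<lambda>(k, e). (v k \<bullet> e) * (C (v k) \<bullet> e))"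
  have sC: "(\<lambda>k. (norm (C (v k)))\<^sup>2) summable_on UNIV"
  proof (rule summable_on_comparison_test[OF summable_on_cmult_right[OF s, of "(norm C)\<^sup>2"]])
    show "(norm (C (v k)))\<^sup>2 \<le> (norm C)\<^sup>2 * (norm (v k))\<^sup>2" for k
      unfolding power_mult_distrib[symmetric] by (intro power_mono norm_blinfun) simp
  qed simp
  have "(\<lambda>(k, e). (v k \<bullet> e)\<^sup>2 + (C (v k) \<bullet> e)\<^sup>2) summable_on UNIV \<times> E"
  proof (rule summable_on_SigmaI[OF _ summable_on_add[OF s sC]])
    show "((\<lambda>e. case (k, e) of (k, e) \<Rightarrow> (v k \<bullet> e)\<^sup>2 + (C (v k) \<bullet> e)\<^sup>2) has_sum
        (norm (v k))\<^sup>2 + (norm (C (v k)))\<^sup>2) E" for k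
      unfolding prod.case by (intro has_sum_add parseval_norm[OF E])
  qed auto
  then have "(\<lambda>p. norm (g p)) summable_on UNIV \<times> E"
  proof (rule Infinite_Sum.abs_summable_on_comparison_test')
    fix p :: "'b \<times> 'a"
    obtain k e where p: "p = (k, e)" by force
    have "2 * \<bar>(v k \<bullet> e) * (C (v k) \<bullet> e)\<bar> \<le> (v k \<bullet> e)\<^sup>2 + (C (v k) \<bullet> e)\<^sup>2"
      using sum_squares_bound[of "\<bar>v k \<bullet> e\<bar>" "\<bar>C (v k) \<bullet> e\<bar>"] by (simp add: abs_mult)
    then show "norm (g p) \<le> (case p of (k, e) \<Rightarrow> (v k \<bullet> e)\<^sup>2 + (C (v k) \<bullet> e)\<^sup>2)"
      by (simp add: p g_def)
  qed
  then have "g summable_on UNIV \<times> E"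
    by (subst summable_on_iff_abs_summable_on_real)
  then obtain S where S: "(g has_sum S) (UNIV \<times> E)" by (auto simp: summable_on_def)
  have "((\<lambda>k. B (v k) \<bullet> v k) has_sum S) UNIV"
  proof (rule has_sum_SigmaD[OF S])
    show "((\<lambda>e. g (k, e)) has_sum B (v k) \<bullet> v k) E" for k
      using parseval[OF E, of "v k" "C (v k)"] C[of "v k" "v k"]
      by (simp add: g_def inner_commute)
  qed
  moreover have "((\<lambda>e. A e \<bullet> B e) has_sum S) E"
  proof (rule has_sum_SigmaD)
    show "((\<lambda>(e, k). g (k, e)) has_sum S) (E \<times> UNIV)"
      using S by (subst (asm) has_sum_swap) (simp add: case_prod_unfold)
    show "((\<lambda>k. case (e, k) of (e, k) \<Rightarrow> g (k, e)) has_sum A e \<bullet> B e) UNIV" for e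
      using v[of e "B e"] by (simp add: g_def C)
  qed
  ultimately show ?thesis by blast
qed

lemma some_onb:
  fixes E :: "'a::{real_inner,complete_space} set"
  shows "is_onb E \<Longrightarrow> is_onb (SOME E :: 'a set. is_onb E)"
  by (rule someI)

lemma S1_plus_imp_nonneg_op: "A \<in> S1_plus \<Longrightarrow> nonneg_op A"
  unfolding S1_plus_def S1_def using selfadjoint_spectrum_nonneg_iff by blast

lemma nonneg_op_in_S1_plus:
  assumes "nonneg_op A" "is_onb E" "(\<lambda>e. A e \<bullet> e) summable_on E"
  shows "A \<in> S1_plus"
proof -
  have "trace_class A" unfolding trace_class_def abs_op_nonneg[OF assms(1)] using assms by blast
  then show ?thesis
    using selfadjoint_spectrum_nonneg_iff[of A] assms(1) by (simp add: S1_plus_def S1_def L1_def)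
qed

abbreviation trace_pairing ::
    "('a::{real_inner,complete_space} \<Rightarrow>\<^sub>L 'a) \<Rightarrow> ('a \<Rightarrow>\<^sub>L 'a) \<Rightarrow> real" where
  "trace_pairing B A \<equiv> trace_op (blinfun_adjoint B o\<^sub>L A)"

text \<open>
  Linearity and monotonicity of the pairing in \<open>B\<close> reduce to those of the single terms
  \<open>\<langle>B v\<^sub>k, v\<^sub>k\<rangle>\<close> of this series.
\<close>

lemma trace_pairing_expansion:
  fixes A :: "'a::{real_inner,complete_space} \<Rightarrow>\<^sub>L 'a"
  assumes sep: "separable_space (euclidean :: 'a topology)" and A: "A \<in> S1_plus"
  shows "\<exists>v :: nat \<Rightarrow> 'a.
    (\<forall>x y. ((\<lambda>k. (v k \<bullet> x) * (v k \<bullet> y)) has_sum (A x \<bullet> y)) UNIV) \<and>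
    (\<forall>B. ((\<lambda>k. blinfun_apply B (v k) \<bullet> v k) has_sum trace_pairing B A) UNIV)"
proof -
  have N: "nonneg_op A" by (rule S1_plus_imp_nonneg_op[OF A])
  obtain v :: "nat \<Rightarrow> 'a" where v: "\<And>x y. ((\<lambda>k. (v k \<bullet> x) * (v k \<bullet> y)) has_sum (A x \<bullet> y)) UNIV"
    using rank_one_decomposition[OF sep N] by blast
  have "trace_class A" using A by (simp add: S1_plus_def S1_def L1_def)
  then obtain E1 where E1: "is_onb E1" "(\<lambda>e. A e \<bullet> e) summable_on E1"
    unfolding trace_class_def abs_op_nonneg[OF N] by blast
  have s: "(\<lambda>k. (norm (v k))\<^sup>2) summable_on UNIV"
    by (rule summable_square_norms_if_diagonal_summable[OF E1(1) v E1(2)])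
  have E0: "is_onb (SOME E :: 'a set. is_onb E)" by (rule some_onb[OF E1(1)])
  have "((\<lambda>k. B (v k) \<bullet> v k) has_sum trace_pairing B A) UNIV" for B :: "'a \<Rightarrow>\<^sub>L 'a"
  proof -
    obtain S where S: "((\<lambda>e. A e \<bullet> B e) has_sum S) (SOME E. is_onb E)"
       "((\<lambda>k. B (v k) \<bullet> v k) has_sum S) UNIV"
      using trace_of_product[OF E0 v s, of B] by blast
    have "trace_pairing B A = S"
      using S(1) by (simp add: trace_op_def blinfun_adjoint_inner infsumI)
    then show ?thesis using S(2) by simp
  qed
  then show ?thesis using v by blast
qed

lemma trace_pairing_id:
  fixes A :: "'a::{real_inner,complete_space} \<Rightarrow>\<^sub>L 'a"
  shows "trace_pairing id_blinfun A = trace_op A"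
proof -
  have "blinfun_adjoint id_blinfun = (id_blinfun :: 'a \<Rightarrow>\<^sub>L 'a)"
    using selfadjoint_op_iff[of id_blinfun] by (simp add: selfadjoint_op_def)
  moreover have "id_blinfun o\<^sub>L A = A" by (rule blinfun_eqI) simp
  ultimately show ?thesis by simp
qed

lemma trace_diagonal_sum:
  fixes A :: "'a::{real_inner,complete_space} \<Rightarrow>\<^sub>L 'a"
  assumes sep: "separable_space (euclidean :: 'a topology)" and A: "A \<in> S1_plus" and E: "is_onb E"
  shows "((\<lambda>e. A e \<bullet> e) has_sum trace_op A) E"
proof -
  from trace_pairing_expansion[OF sep A] obtain v :: "nat \<Rightarrow> 'a" where
    v: "(\<forall>x y. ((\<lambda>k. (v k \<bullet> x) * (v k \<bullet> y)) has_sum (A x \<bullet> y)) UNIV) \<and>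
      (\<forall>B. ((\<lambda>k. blinfun_apply B (v k) \<bullet> v k) has_sum trace_pairing B A) UNIV)" ..
  from v have tr: "((\<lambda>k. blinfun_apply id_blinfun (v k) \<bullet> v k) has_sum trace_op A) UNIV"
    by (metis trace_pairing_id)
  then have "(\<lambda>k. (norm (v k))\<^sup>2) summable_on UNIV"
    by (auto simp: summable_on_def power2_norm_eq_inner)
  from trace_of_product[OF E _ this, of A id_blinfun] v
  obtain S where S: "((\<lambda>e. A e \<bullet> blinfun_apply id_blinfun e) has_sum S) E"
      "((\<lambda>k. blinfun_apply id_blinfun (v k) \<bullet> v k) has_sum S) UNIV" by blast
  have "S = trace_op A" by (rule has_sum_unique[OF S(2) tr])
  then show ?thesis using S(1) by simp
qed

section \<open>The trace pairing on nonnegative trace class operators\<close>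

lemma trace_pairing_series:
  fixes A :: "'a::{real_inner,complete_space} \<Rightarrow>\<^sub>L 'a"
  assumes sep: "separable_space (euclidean :: 'a topology)" and A: "A \<in> S1_plus"
  shows "\<exists>v :: nat \<Rightarrow> 'a. \<forall>B. ((\<lambda>k. blinfun_apply B (v k) \<bullet> v k) has_sum trace_pairing B A) UNIV"
  using trace_pairing_expansion[OF sep A] by (elim exE conjE) (rule exI)

lemma S1_plus_imp_selfadjoint: "A \<in> S1_plus \<Longrightarrow> selfadjoint_op A"
  using S1_plus_imp_nonneg_op nonneg_op_def by blast

lemma trace_pairing_add:
  fixes A B C :: "'a::{real_inner,complete_space} \<Rightarrow>\<^sub>L 'a"
  assumes sep: "separable_space (euclidean :: 'a topology)" and A: "A \<in> S1_plus"
  shows "trace_pairing (B + C) A = trace_pairing B A + trace_pairing C A"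
proof -
  from trace_pairing_series[OF sep A] obtain v :: "nat \<Rightarrow> 'a" where
    v: "\<forall>B. ((\<lambda>k. blinfun_apply B (v k) \<bullet> v k) has_sum trace_pairing B A) UNIV" ..
  note T = v[rule_format]
  have "((\<lambda>k. blinfun_apply (B + C) (v k) \<bullet> v k) has_sum (trace_pairing B A + trace_pairing C A)) UNIV"
    using has_sum_add[OF T[of B] T[of C]] by (simp add: blinfun.add_left inner_add_left)
  then show ?thesis by (rule has_sum_unique[OF T])
qed

lemma trace_pairing_scaleR:
  fixes A B :: "'a::{real_inner,complete_space} \<Rightarrow>\<^sub>L 'a"
  assumes sep: "separable_space (euclidean :: 'a topology)" and A: "A \<in> S1_plus"
  shows "trace_pairing (c *\<^sub>R B) A = c * trace_pairing B A"
proof -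
  from trace_pairing_series[OF sep A] obtain v :: "nat \<Rightarrow> 'a" where
    v: "\<forall>B. ((\<lambda>k. blinfun_apply B (v k) \<bullet> v k) has_sum trace_pairing B A) UNIV" ..
  note T = v[rule_format]
  have "((\<lambda>k. blinfun_apply (c *\<^sub>R B) (v k) \<bullet> v k) has_sum (c * trace_pairing B A)) UNIV"
    using has_sum_cmult_right[OF T[of B], of c] by (simp add: blinfun.scaleR_left)
  then show ?thesis by (rule has_sum_unique[OF T])
qed

lemma trace_pairing_diff:
  fixes A B C :: "'a::{real_inner,complete_space} \<Rightarrow>\<^sub>L 'a"
  assumes sep: "separable_space (euclidean :: 'a topology)" and A: "A \<in> S1_plus"
  shows "trace_pairing (B - C) A = trace_pairing B A - trace_pairing C A"
  using trace_pairing_add[OF sep A, of "B - C" C] by simp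

lemma trace_pairing_sum:
  fixes A :: "'a::{real_inner,complete_space} \<Rightarrow>\<^sub>L 'a"
  assumes sep: "separable_space (euclidean :: 'a topology)" and A: "A \<in> S1_plus"
  shows "trace_pairing (\<Sum>i\<in>I. B i) A = (\<Sum>i\<in>I. trace_pairing (B i) A)"
proof (induction I rule: infinite_finite_induct)
  case (insert i I)
  then show ?case by (simp add: trace_pairing_add[OF sep A])
qed (use trace_pairing_scaleR[OF sep A, of 0 0] in simp_all)

lemma trace_pairing_nonneg:
  fixes A B :: "'a::{real_inner,complete_space} \<Rightarrow>\<^sub>L 'a"
  assumes sep: "separable_space (euclidean :: 'a topology)" and A: "A \<in> S1_plus"
    and B: "\<And>x. 0 \<le> B x \<bullet> x"
  shows "0 \<le> trace_pairing B A"
proof -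
  from trace_pairing_series[OF sep A] obtain v :: "nat \<Rightarrow> 'a" where
    v: "\<forall>B. ((\<lambda>k. blinfun_apply B (v k) \<bullet> v k) has_sum trace_pairing B A) UNIV" ..
  note T = v[rule_format]
  show ?thesis by (rule has_sum_nonneg[OF T B])
qed

lemma trace_nonneg:
  fixes A :: "'a::{real_inner,complete_space} \<Rightarrow>\<^sub>L 'a"
  assumes "separable_space (euclidean :: 'a topology)" and "A \<in> S1_plus"
  shows "0 \<le> trace_op A"
  using trace_pairing_nonneg[OF assms, of id_blinfun] by (simp add: trace_pairing_id)

text \<open>
  Monotonicity in \<open>B\<close>, applied to \<open>\<plusminus> B \<le> \<parallel>B\<parallel> I\<close> in the sense of quadratic forms.
\<close>

lemma trace_pairing_bound:
  fixes A B :: "'a::{real_inner,complete_space} \<Rightarrow>\<^sub>L 'a"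
  assumes sep: "separable_space (euclidean :: 'a topology)" and A: "A \<in> S1_plus"
  shows "\<bar>trace_pairing B A\<bar> \<le> norm B * trace_op A"
proof -
  have upper: "trace_pairing C A \<le> norm C * trace_op A" for C :: "'a \<Rightarrow>\<^sub>L 'a"
  proof -
    have "0 \<le> (norm C *\<^sub>R id_blinfun - C) x \<bullet> x" for x
    proof -
      have "C x \<bullet> x \<le> norm C * norm x * norm x"
        by (rule order_trans[OF norm_cauchy_schwarz]) (intro mult_right_mono norm_blinfun norm_ge_zero)
      then show ?thesis
        by (simp add: blinfun.bilinear_simps inner_simps dot_square_norm power2_eq_square mult.assoc)
    qed
    from trace_pairing_nonneg[OF sep A this] show ?thesis
      by (simp add: trace_pairing_diff[OF sep A] trace_pairing_scaleR[OF sep A] trace_pairing_id)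
  qed
  have "trace_pairing (- B) A = - trace_pairing B A"
    using trace_pairing_scaleR[OF sep A, of "-1" B] by simp
  then show ?thesis using upper[of B] upper[of "- B"] by simp
qed

text \<open>
  Parseval's identity alone gives this value, so it holds for every self-adjoint operator.  In this
  generality it detects the sign of the quadratic form of an arbitrary member of \<open>S1\<close>.
\<close>

lemma trace_pairing_rank_one:
  fixes A :: "'a::{real_inner,complete_space} \<Rightarrow>\<^sub>L 'a"
  assumes sep: "separable_space (euclidean :: 'a topology)" and A: "selfadjoint_op A"
  shows "trace_pairing (rank_one_op u w) A = A w \<bullet> u"
proof -
  define E where "E = (SOME E :: 'a set. is_onb E)"
  have E: "is_onb E" using onb_exists[OF sep] some_onb unfolding E_def by blast
  have "(blinfun_adjoint (rank_one_op u w) o\<^sub>L A) e \<bullet> e = (A u \<bullet> e) * (w \<bullet> e)" for e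
  proof -
    have "(blinfun_adjoint (rank_one_op u w) o\<^sub>L A) e \<bullet> e = (w \<bullet> e) * (A e \<bullet> u)"
      by (simp add: blinfun_adjoint_inner)
    also have "A e \<bullet> u = A u \<bullet> e" using A by (metis selfadjoint_op_iff inner_commute)
    finally show ?thesis by (simp add: mult.commute)
  qed
  then have "trace_pairing (rank_one_op u w) A = A u \<bullet> w"
    using parseval[OF E, of "A u" w] by (simp add: trace_op_def E_def[symmetric] infsumI)
  then show ?thesis using A by (metis selfadjoint_op_iff inner_commute)
qed

lemma S1_plus_form_bound:
  fixes A :: "'a::{real_inner,complete_space} \<Rightarrow>\<^sub>L 'a"
  assumes sep: "separable_space (euclidean :: 'a topology)" and A: "A \<in> S1_plus"
  shows "\<bar>A x \<bullet> y\<bar> \<le> trace_op A * norm x * norm y"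
proof -
  have "\<bar>A x \<bullet> y\<bar> \<le> norm (rank_one_op y x) * trace_op A"
    using trace_pairing_bound[OF sep A, of "rank_one_op y x"]
    by (simp add: trace_pairing_rank_one[OF sep S1_plus_imp_selfadjoint[OF A]])
  also have "\<dots> \<le> (norm y * norm x) * trace_op A"
    by (intro mult_right_mono norm_rank_one_op trace_nonneg[OF sep A])
  finally show ?thesis by (simp add: mult_ac)
qed

lemma convex_cone_S1_plus:
  assumes sep: "separable_space (euclidean :: 'a::{real_inner,complete_space} topology)"
  shows "convex_cone (S1_plus :: ('a \<Rightarrow>\<^sub>L 'a) set)"
  unfolding convex_cone_iff
proof (intro conjI ballI allI impI)
  obtain E :: "'a set" where E: "is_onb E" using onb_exists[OF sep] by blast
  show "(0 :: 'a \<Rightarrow>\<^sub>L 'a) \<in> S1_plus"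
    by (rule nonneg_op_in_S1_plus[OF _ E]) (auto simp: nonneg_op_iff)
  fix A :: "'a \<Rightarrow>\<^sub>L 'a" assume A: "A \<in> S1_plus"
  note N = S1_plus_imp_nonneg_op
  {
    fix B :: "'a \<Rightarrow>\<^sub>L 'a" assume B: "B \<in> S1_plus"
    have "(\<lambda>e. A e \<bullet> e + B e \<bullet> e) summable_on E"
      using has_sum_add[OF trace_diagonal_sum[OF sep A E] trace_diagonal_sum[OF sep B E]]
      by (auto simp: summable_on_def)
    then show "A + B \<in> S1_plus"
      using N[OF A] N[OF B]
      by (intro nonneg_op_in_S1_plus[OF _ E])
         (auto simp: nonneg_op_iff blinfun.add_left inner_add_left inner_add_right)
  }
  fix c :: real assume c: "0 \<le> c"
  have "(\<lambda>e. c * (A e \<bullet> e)) summable_on E"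
    using has_sum_cmult_right[OF trace_diagonal_sum[OF sep A E]] by (auto simp: summable_on_def)
  then show "c *\<^sub>R A \<in> S1_plus"
    using N[OF A] c
    by (intro nonneg_op_in_S1_plus[OF _ E]) (auto simp: nonneg_op_iff blinfun.scaleR_left)
qed

section \<open>Compact operators\<close>

lemma compact_opI:
  assumes "compact K" "blinfun_apply B ` cball 0 1 \<subseteq> K"
  shows "compact_op B"
proof -
  have "closure (blinfun_apply B ` cball 0 1) \<subseteq> K"
    by (rule closure_minimal[OF assms(2)]) (rule compact_imp_closed[OF assms(1)])
  then have "compact (K \<inter> closure (blinfun_apply B ` cball 0 1))"
    by (intro compact_Int_closed assms closed_closure)
  then show ?thesis
    using \<open>closure (blinfun_apply B ` cball 0 1) \<subseteq> K\<close> by (simp add: compact_op_def inf_absorb2)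
qed

lemma compact_op_rank_one: "compact_op (rank_one_op u w)"
proof (rule compact_opI)
  show "compact ((\<lambda>t. t *\<^sub>R u) ` {- norm w..norm w})"
    by (intro compact_continuous_image continuous_intros compact_Icc)
  show "blinfun_apply (rank_one_op u w) ` cball 0 1 \<subseteq> (\<lambda>t. t *\<^sub>R u) ` {- norm w..norm w}"
  proof (rule image_subsetI)
    fix x :: 'a assume "x \<in> cball 0 1"
    then have "\<bar>w \<bullet> x\<bar> \<le> norm w"
      using Cauchy_Schwarz_ineq2[of w x] mult_left_mono[of "norm x" 1 "norm w"] by simp
    then have "w \<bullet> x \<in> {- norm w..norm w}" by auto
    then show "rank_one_op u w x \<in> (\<lambda>t. t *\<^sub>R u) ` {- norm w..norm w}"
      unfolding rank_one_op_apply by (rule imageI)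
  qed
qed

lemma compact_op_0: "compact_op 0"
  by (rule compact_opI[of "{0}"]) auto

lemma compact_op_add:
  assumes "compact_op B" "compact_op C"
  shows "compact_op (B + C)"
proof (rule compact_opI)
  show "compact {x + y | x y. x \<in> closure (blinfun_apply B ` cball 0 1) \<and>
      y \<in> closure (blinfun_apply C ` cball 0 1)}"
    using assms by (intro compact_sums) (auto simp: compact_op_def)
  show "blinfun_apply (B + C) ` cball 0 1 \<subseteq> {x + y | x y. x \<in> closure (blinfun_apply B ` cball 0 1) \<and>
      y \<in> closure (blinfun_apply C ` cball 0 1)}"
  proof (rule image_subsetI)
    fix x :: 'a assume "x \<in> cball 0 1"
    then have "B x \<in> closure (blinfun_apply B ` cball 0 1)" "C x \<in> closure (blinfun_apply C ` cball 0 1)"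
      by (meson closure_subset image_eqI subsetD)+
    then show "(B + C) x \<in> {x + y | x y. x \<in> closure (blinfun_apply B ` cball 0 1) \<and>
      y \<in> closure (blinfun_apply C ` cball 0 1)}"
      by (auto simp: blinfun.add_left)
  qed
qed

lemma compact_op_sum: "(\<And>i. i \<in> I \<Longrightarrow> compact_op (B i)) \<Longrightarrow> compact_op (\<Sum>i\<in>I. B i)"
  by (induction I rule: infinite_finite_induct) (auto intro: compact_op_0 compact_op_add)

text \<open>
  The operator in the sum is \<open>P\<^sub>F B\<close> with the orthogonal projection \<open>P\<^sub>F\<close> onto the span of \<open>F\<close>.  The image
  of the unit ball has a finite net, and \<open>F\<close> is chosen so that \<open>P\<^sub>F\<close> nearly fixes every point of it.
\<close>

lemma compact_op_finite_rank_approximation: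
  fixes B :: "'a::{real_inner,complete_space} \<Rightarrow>\<^sub>L 'a"
  assumes E: "is_onb E" and B: "compact_op B" and e: "0 < \<epsilon>"
  obtains F where "finite F" "F \<subseteq> E"
    "norm (B - (\<Sum>f\<in>F. rank_one_op f (blinfun_adjoint B f))) \<le> \<epsilon>"
proof -
  define C where "C = closure (blinfun_apply B ` cball 0 1)"
  define r where "r = \<epsilon> / 2"
  have r: "0 < r" using e by (simp add: r_def)
  have "compact C" using B by (simp add: C_def compact_op_def)
  then obtain k where k: "finite k" "C \<subseteq> (\<Union>c\<in>k. ball c r)"
    unfolding compact_eq_totally_bounded using r by blast
  have "\<forall>c. \<exists>F0. finite F0 \<and> F0 \<subseteq> E \<and>
      (\<forall>F. finite F \<and> F0 \<subseteq> F \<and> F \<subseteq> E \<longrightarrow> norm (c - proj_onto F c) < r)"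
    using onb_approximation[OF E r] by (intro allI)
  from choice[OF this] obtain G where G_all: "\<forall>c. finite (G c) \<and> G c \<subseteq> E \<and>
      (\<forall>F. finite F \<and> G c \<subseteq> F \<and> F \<subseteq> E \<longrightarrow> norm (c - proj_onto F c) < r)" ..
  then have G: "finite (G c)" "G c \<subseteq> E" for c by auto
  have close: "norm (c - proj_onto F c) < r" if "finite F" "G c \<subseteq> F" "F \<subseteq> E" for c F
    using G_all that by blast
  define F where "F = (\<Union>c\<in>k. G c)"
  have F: "finite F" "F \<subseteq> E" using k(1) G by (auto simp: F_def)
  have near: "norm (y - proj_onto F y) \<le> \<epsilon>" if y: "y \<in> C" for y
  proof -
    obtain c where c: "c \<in> k" "dist c y < r" using k(2) y by auto
    have span: "proj_onto F c \<in> span F"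
      unfolding proj_onto_def by (intro span_sum span_scale span_base)
    have "norm (y - proj_onto F y) \<le> norm (y - proj_onto F c)"
      by (rule proj_onto_best_approximation[OF E F span])
    also have "\<dots> \<le> norm (y - c) + norm (c - proj_onto F c)"
      using norm_triangle_ineq[of "y - c" "c - proj_onto F c"] by simp
    also have "\<dots> \<le> r + r"
    proof (rule add_mono)
      show "norm (y - c) \<le> r" using c(2) by (simp add: dist_norm norm_minus_commute)
      have "G c \<subseteq> F" using c(1) by (auto simp: F_def)
      then show "norm (c - proj_onto F c) \<le> r" using close[OF F(1) _ F(2)] by (simp add: less_imp_le)
    qed
    finally show ?thesis by (simp add: r_def)
  qed
  define T where "T = (\<Sum>f\<in>F. rank_one_op f (blinfun_adjoint B f))"
  have T: "T x = proj_onto F (B x)" for x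
    by (simp add: T_def proj_onto_def blinfun.sum_left blinfun_adjoint_inner inner_commute[of "blinfun_apply B x"])
  have "norm (B - T) \<le> \<epsilon>"
  proof (rule norm_blinfun_bound)
    fix x
    show "norm ((B - T) x) \<le> \<epsilon> * norm x"
    proof (cases "x = 0")
      case False
      have "B (sgn x) \<in> C"
        unfolding C_def by (rule subsetD[OF closure_subset]) (simp add: norm_sgn)
      then have "norm ((B - T) (sgn x)) \<le> \<epsilon>" using near by (simp add: blinfun.diff_left T)
      then show ?thesis using False by (simp add: sgn_div_norm blinfun.scaleR_right field_simps)
    qed simp
  qed (use e in simp)
  then show thesis using that[of F] F by (simp add: T_def)
qed

section \<open>Duality with nonnegative test operators\<close>

text \<open>
  The pairing equals \<open>tr ((B + y I) A) + x y\<close>.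
\<close>

lemma pairing_nonneg:
  fixes A :: "'a::{real_inner,complete_space} \<Rightarrow>\<^sub>L 'a"
  assumes sep: "separable_space (euclidean :: 'a topology)" and A: "A \<in> S1_plus"
    and "0 \<le> x" "0 \<le> y" and B: "nonneg_op (B + y *\<^sub>R id_blinfun)"
  shows "0 \<le> pairing (A, x) (B, y)"
proof -
  have "pairing (A, x) (B, y) = trace_pairing (B + y *\<^sub>R id_blinfun) A + x * y"
    by (simp add: pairing_def trace_pairing_add[OF sep A] trace_pairing_scaleR[OF sep A]
        trace_pairing_id algebra_simps)
  also have "\<dots> \<ge> 0"
    using assms by (intro add_nonneg_nonneg trace_pairing_nonneg[OF sep A]) (auto simp: nonneg_op_def)
  finally show ?thesis .
qed

text \<open>
  Two families of test pairs suffice.  With \<open>(u \<otimes> u, 0)\<close> one reads off \<open>\<langle>A u, u\<rangle> \<ge> 0\<close>.  With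
  \<open>(- P\<^sub>F, 1)\<close>, where \<open>P\<^sub>F\<close> projects onto the span of finitely many basis vectors, one gets
  \<open>tr A + x \<ge> \<Sum>\<^sub>f \<langle>A f, f\<rangle>\<close>; letting \<open>F\<close> grow yields \<open>x \<ge> 0\<close>.
\<close>

lemma mem_cone_if_pairing_nonneg:
  fixes A :: "'a::{real_inner,complete_space} \<Rightarrow>\<^sub>L 'a"
  assumes sep: "separable_space (euclidean :: 'a topology)" and A: "A \<in> S1"
    and pair: "\<And>B y. B \<in> Sc \<Longrightarrow> 0 \<le> y \<Longrightarrow> nonneg_op (B + y *\<^sub>R id_blinfun) \<Longrightarrow> 0 \<le> pairing (A, x) (B, y)"
  shows "A \<in> S1_plus \<and> 0 \<le> x"
proof -
  have sa: "selfadjoint_op A" using A by (simp add: S1_def)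
  have "0 \<le> A u \<bullet> u" for u
  proof -
    have N: "nonneg_op (rank_one_op u u)" by (auto simp: nonneg_op_iff inner_commute)
    then have "rank_one_op u u \<in> Sc" by (simp add: Sc_def nonneg_op_def compact_op_rank_one)
    from pair[OF this, of 0] N show ?thesis
      by (simp add: pairing_def trace_pairing_rank_one[OF sep sa])
  qed
  then have "nonneg_op A" using sa by (simp add: nonneg_op_def)
  then have plus: "A \<in> S1_plus"
    using A selfadjoint_spectrum_nonneg_iff[of A] by (simp add: S1_plus_def)
  obtain E :: "'a set" where E: "is_onb E" using onb_exists[OF sep] by blast
  have "trace_op A \<le> trace_op A + x"
  proof (rule has_sum_le_finite_sums[OF trace_diagonal_sum[OF sep plus E]])
    fix F assume F: "finite F" "F \<subseteq> E"
    define P where "P = (\<Sum>f\<in>F. rank_one_op (- f) f)"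
    have P: "P x = - proj_onto F x" for x
      by (simp add: P_def proj_onto_def blinfun.sum_left sum_negf inner_commute)
    have P_inner: "P x \<bullet> y = - (\<Sum>f\<in>F. (x \<bullet> f) * (f \<bullet> y))" for x y
      by (simp add: P proj_onto_def inner_sum_left)
    have P_sym: "P x \<bullet> y = x \<bullet> P y" for x y
      unfolding inner_commute[of x] P_inner by (simp add: inner_commute mult.commute)
    have "0 \<le> (P + 1 *\<^sub>R id_blinfun) x \<bullet> x" for x
    proof -
      have "(P + 1 *\<^sub>R id_blinfun) x \<bullet> x = P x \<bullet> x + (norm x)\<^sup>2"
        by (simp add: blinfun.add_left inner_add_left dot_square_norm)
      also have "P x \<bullet> x = - (\<Sum>f\<in>F. (x \<bullet> f)\<^sup>2)"
        unfolding P_inner by (simp add: power2_eq_square inner_commute[of _ x])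
      finally show ?thesis using bessel[OF E F, of x] by simp
    qed
    then have N: "nonneg_op (P + 1 *\<^sub>R id_blinfun)"
      using P_sym by (simp add: nonneg_op_iff blinfun.bilinear_simps inner_simps)
    have "P \<in> Sc"
      unfolding Sc_def P_def[symmetric] selfadjoint_op_iff using P_sym
      by (auto simp: P_def intro!: compact_op_sum compact_op_rank_one)
    from pair[OF this _ N] have "0 \<le> trace_pairing P A + (trace_op A + x)" by (simp add: pairing_def)
    moreover have "trace_pairing P A = - (\<Sum>f\<in>F. A f \<bullet> f)"
      by (simp add: P_def trace_pairing_sum[OF sep plus] trace_pairing_rank_one[OF sep sa] sum_negf)
    ultimately show "(\<Sum>f\<in>F. A f \<bullet> f) \<le> trace_op A + x" by simp
  qed
  then show ?thesis using plus by simp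
qed

section \<open>Limits of bounded sequences of operators\<close>

lemma blinfun_eq_if_forms_agree_on_dense:
  fixes A B :: "'a::{real_inner,complete_space} \<Rightarrow>\<^sub>L 'a"
  assumes d: "closure (range d) = UNIV" and eq: "\<And>i j. A (d i) \<bullet> d j = B (d i) \<bullet> d j"
  shows "A = B"
proof -
  have 1: "A x \<bullet> d j = B x \<bullet> d j" for x j
  proof -
    have "closed {x. A x \<bullet> d j = B x \<bullet> d j}" by (intro closed_Collect_eq continuous_intros)
    then have "closure (range d) \<subseteq> {x. A x \<bullet> d j = B x \<bullet> d j}"
      by (intro closure_minimal) (auto simp: eq)
    then show ?thesis using d by auto
  qed
  have "A x \<bullet> y = B x \<bullet> y" for x y
  proof -
    have "closed {y. A x \<bullet> y = B x \<bullet> y}" by (intro closed_Collect_eq continuous_intros)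
    then have "closure (range d) \<subseteq> {y. A x \<bullet> y = B x \<bullet> y}"
      by (intro closure_minimal) (auto simp: 1)
    then show ?thesis using d by auto
  qed
  then have "A x = B x" for x by (intro vector_eq_rdot[THEN iffD1]) simp
  then show ?thesis by (rule blinfun_eqI)
qed

text \<open>
  Uniform boundedness extends convergence from the dense sequence to all vectors, and the limit form
  is again bounded and bilinear, hence given by an operator.
\<close>

lemma bounded_forms_converge_if_on_dense:
  fixes A :: "nat \<Rightarrow> 'a::{real_inner,complete_space} \<Rightarrow>\<^sub>L 'a"
  assumes d: "closure (range d) = UNIV"
    and bound: "\<And>m x y. \<bar>A m x \<bullet> y\<bar> \<le> c * norm x * norm y"
    and conv: "\<And>i j. convergent (\<lambda>m. A m (d i) \<bullet> d j)"
  shows "\<exists>L. \<forall>x y. (\<lambda>m. A m x \<bullet> y) \<longlonglongrightarrow> blinfun_apply L x \<bullet> y"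
proof -
  have approx: "\<exists>i. norm (x - d i) < r" if "0 < r" for x r
  proof -
    have "x \<in> closure (range d)" using d by simp
    then show ?thesis using that by (auto simp: closure_approachable dist_norm norm_minus_commute)
  qed
  have conv': "convergent (\<lambda>m. A m x \<bullet> y)" for x y
  proof (rule Cauchy_convergent, rule metric_CauchyI)
    fix \<epsilon> :: real assume e: "0 < \<epsilon>"
    define C where "C = \<bar>c\<bar> + 1"
    have C: "0 < C" by (simp add: C_def)
    have bound': "\<bar>A m x \<bullet> y\<bar> \<le> C * norm x * norm y" for m x y
      by (rule order_trans[OF bound]) (intro mult_right_mono norm_ge_zero, simp add: C_def)
    have y1: "0 < norm y + 1" by (simp add: add_nonneg_pos)
    obtain i where i: "norm (x - d i) < \<epsilon> / (6 * C * (norm y + 1))" 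
      using approx e C y1 by (metis divide_pos_pos mult_pos_pos zero_less_numeral)
    have x1: "0 < norm (d i) + 1" by (simp add: add_nonneg_pos)
    obtain j where j: "norm (y - d j) < \<epsilon> / (6 * C * (norm (d i) + 1))"
      using approx e C x1 by (metis divide_pos_pos mult_pos_pos zero_less_numeral)
    have near: "\<bar>A m x \<bullet> y - A m (d i) \<bullet> d j\<bar> \<le> \<epsilon> / 3" for m
    proof -
      have "A m x \<bullet> y - A m (d i) \<bullet> d j = A m (x - d i) \<bullet> y + A m (d i) \<bullet> (y - d j)"
        by (simp add: blinfun.diff_right inner_simps)
      then have "\<bar>A m x \<bullet> y - A m (d i) \<bullet> d j\<bar> \<le> C * norm (x - d i) * norm y + C * norm (d i) * norm (y - d j)"
        using bound'[of m "x - d i" y] bound'[of m "d i" "y - d j"] by linarith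
      also have "\<dots> \<le> C * norm (x - d i) * (norm y + 1) + C * (norm (d i) + 1) * norm (y - d j)"
        using C by (intro add_mono mult_left_mono mult_right_mono) auto
      also have "\<dots> \<le> \<epsilon> / 6 + \<epsilon> / 6"
      proof (rule add_mono)
        have "norm (x - d i) * (6 * C * (norm y + 1)) < \<epsilon>"
          using i C y1 by (simp add: pos_less_divide_eq)
        then show "C * norm (x - d i) * (norm y + 1) \<le> \<epsilon> / 6" by (simp add: algebra_simps)
        have "norm (y - d j) * (6 * C * (norm (d i) + 1)) < \<epsilon>"
          using j C x1 by (simp add: pos_less_divide_eq)
        then show "C * (norm (d i) + 1) * norm (y - d j) \<le> \<epsilon> / 6" by (simp add: algebra_simps)
      qed
      finally show ?thesis by simp
    qed
    have "Cauchy (\<lambda>m. A m (d i) \<bullet> d j)" using conv convergent_Cauchy by blast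
    then obtain M where M: "\<And>m n. m \<ge> M \<Longrightarrow> n \<ge> M \<Longrightarrow> dist (A m (d i) \<bullet> d j) (A n (d i) \<bullet> d j) < \<epsilon> / 3"
      using e by (metis metric_CauchyD zero_less_divide_iff zero_less_numeral)
    have "dist (A m x \<bullet> y) (A n x \<bullet> y) < \<epsilon>" if "m \<ge> M" "n \<ge> M" for m n
      using near[of m] near[of n] M[OF that] unfolding dist_real_def by linarith
    then show "\<exists>M. \<forall>m\<ge>M. \<forall>n\<ge>M. dist (A m x \<bullet> y) (A n x \<bullet> y) < \<epsilon>" by blast
  qed
  define b where "b x y = lim (\<lambda>m. A m x \<bullet> y)" for x y
  have b: "(\<lambda>m. A m x \<bullet> y) \<longlonglongrightarrow> b x y" for x y
    unfolding b_def using conv' convergent_LIMSEQ_iff by blast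
  have "bounded_bilinear b"
  proof
    show "b (x + x') y = b x y + b x' y" for x x' y
      by (rule LIMSEQ_unique[OF b]) (simp add: blinfun.add_right inner_add_left tendsto_add b)
    show "b x (y + y') = b x y + b x y'" for x y y'
      by (rule LIMSEQ_unique[OF b]) (simp add: inner_add_right tendsto_add b)
    show "b (r *\<^sub>R x) y = r *\<^sub>R b x y" for r x y
      by (rule LIMSEQ_unique[OF b]) (simp add: blinfun.scaleR_right tendsto_mult_left b)
    show "b x (r *\<^sub>R y) = r *\<^sub>R b x y" for r x y
      by (rule LIMSEQ_unique[OF b]) (simp add: tendsto_mult_left b)
    have "norm (b x y) \<le> norm x * norm y * c" for x y
      unfolding real_norm_def
      by (rule LIMSEQ_le_const2[OF tendsto_rabs[OF b]]) (use bound[of _ x y] in \<open>auto simp: mult_ac\<close>)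
    then show "\<exists>K. \<forall>x y. norm (b x y) \<le> norm x * norm y * K" by blast
  qed
  from blinfun_of_bounded_form[OF this] obtain L where "\<forall>x y. blinfun_apply L x \<bullet> y = b x y" ..
  then have "\<forall>x y. (\<lambda>m. A m x \<bullet> y) \<longlonglongrightarrow> L x \<bullet> y" using b by simp
  then show ?thesis ..
qed

text \<open>
  Finite partial sums of the diagonal pass to the limit, so the trace is lower semicontinuous.
\<close>

lemma S1_plus_limit:
  fixes A :: "nat \<Rightarrow> 'a::{real_inner,complete_space} \<Rightarrow>\<^sub>L 'a" and L :: "'a \<Rightarrow>\<^sub>L 'a"
  assumes sep: "separable_space (euclidean :: 'a topology)"
    and A: "\<And>m. A m \<in> S1_plus"
    and lim: "\<And>x y. (\<lambda>m. A m x \<bullet> y) \<longlonglongrightarrow> L x \<bullet> y"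
    and N: "N \<longlonglongrightarrow> \<nu>" "\<And>m. trace_op (A m) \<le> N m"
  shows "L \<in> S1_plus \<and> trace_op L \<le> \<nu>"
proof -
  obtain E :: "'a set" where E: "is_onb E" using onb_exists[OF sep] by blast
  note pos = S1_plus_imp_nonneg_op[OF A]
  have L: "nonneg_op L"
    unfolding nonneg_op_iff
  proof (intro conjI allI)
    show "L x \<bullet> y = x \<bullet> L y" for x y
      using LIMSEQ_unique[OF lim[of x y]] lim[of y x] nonneg_op_symmetric[OF pos, of _ x y]
      by (simp add: inner_commute)
    show "0 \<le> L x \<bullet> x" for x
      by (rule LIMSEQ_le_const[OF lim]) (use nonneg_op_ge0[OF pos] in auto)
  qed
  have partial: "(\<Sum>e\<in>F. L e \<bullet> e) \<le> \<nu>" if F: "finite F" "F \<subseteq> E" for F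
  proof (rule LIMSEQ_le)
    show "(\<lambda>m. \<Sum>e\<in>F. A m e \<bullet> e) \<longlonglongrightarrow> (\<Sum>e\<in>F. L e \<bullet> e)" by (intro tendsto_sum lim)
    show "N \<longlonglongrightarrow> \<nu>" by (rule N)
    have "(\<Sum>e\<in>F. A m e \<bullet> e) \<le> N m" for m
    proof (rule order_trans[OF _ N(2)])
      show "(\<Sum>e\<in>F. A m e \<bullet> e) \<le> trace_op (A m)"
        by (rule has_sum_mono2[OF has_sum_finite[OF F(1)] trace_diagonal_sum[OF sep A E] F(2)])
           (rule nonneg_op_ge0[OF pos])
    qed
    then show "\<exists>M. \<forall>m\<ge>M. (\<Sum>e\<in>F. A m e \<bullet> e) \<le> N m" by blast
  qed
  have "(\<lambda>e. L e \<bullet> e) summable_on E"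
    by (rule nonneg_bdd_above_summable_on)
       (use nonneg_op_ge0[OF L] partial in \<open>auto intro!: bdd_aboveI2[where M=\<nu>]\<close>)
  then have plus: "L \<in> S1_plus" by (rule nonneg_op_in_S1_plus[OF L E])
  then show ?thesis using has_sum_le_finite_sums[OF trace_diagonal_sum[OF sep plus E] partial] by blast
qed

text \<open>
  For finite rank \<open>B\<close> the pairing is a finite sum of numbers \<open>\<langle>A w, f\<rangle>\<close>.  A compact \<open>B\<close> is a norm limit
  of such operators, and the error is at most the norm distance times the bound on the traces.
\<close>

lemma trace_pairing_tendsto:
  fixes A :: "nat \<Rightarrow> 'a::{real_inner,complete_space} \<Rightarrow>\<^sub>L 'a" and L :: "'a \<Rightarrow>\<^sub>L 'a"
  assumes sep: "separable_space (euclidean :: 'a topology)"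
    and A: "\<And>m. A m \<in> S1_plus" "\<And>m. trace_op (A m) \<le> c"
    and lim: "\<And>x y. (\<lambda>m. A m x \<bullet> y) \<longlonglongrightarrow> L x \<bullet> y"
    and B: "compact_op B"
  shows "(\<lambda>m. trace_pairing B (A m)) \<longlonglongrightarrow> trace_pairing B L"
proof (rule LIMSEQ_I)
  fix \<epsilon> :: real assume e: "0 < \<epsilon>"
  have "L \<in> S1_plus \<and> trace_op L \<le> c"
    by (rule S1_plus_limit[OF sep A(1) lim tendsto_const A(2)])
  then have L: "L \<in> S1_plus" "trace_op L \<le> c" by auto
  have c: "0 \<le> c" using trace_nonneg[OF sep L(1)] L(2) by linarith
  define r where "r = \<epsilon> / (3 * (c + 1))"
  have r: "0 < r" "r * c \<le> \<epsilon> / 3" using e c by (auto simp: r_def field_simps)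
  obtain E :: "'a set" where E: "is_onb E" using onb_exists[OF sep] by blast
  define T where "T F = (\<Sum>f\<in>F. rank_one_op f (blinfun_adjoint B f))" for F
  obtain F where F: "norm (B - T F) \<le> r"
    using compact_op_finite_rank_approximation[OF E B r(1)] unfolding T_def by metis
  have near: "\<bar>trace_pairing B C - trace_pairing (T F) C\<bar> \<le> \<epsilon> / 3"
    if C: "C \<in> S1_plus" "trace_op C \<le> c" for C
  proof -
    have "\<bar>trace_pairing B C - trace_pairing (T F) C\<bar> \<le> norm (B - T F) * trace_op C"
      using trace_pairing_bound[OF sep C(1), of "B - T F"] by (simp add: trace_pairing_diff[OF sep C(1)])
    also have "\<dots> \<le> r * c" using F C trace_nonneg[OF sep C(1)] r(1) by (intro mult_mono) auto
    finally show ?thesis using r(2) by linarith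
  qed
  have T: "trace_pairing (T F) C = (\<Sum>f\<in>F. C (blinfun_adjoint B f) \<bullet> f)" if "C \<in> S1_plus" for C
    by (simp add: T_def trace_pairing_sum[OF sep that] trace_pairing_rank_one[OF sep S1_plus_imp_selfadjoint[OF that]])
  have "(\<lambda>m. trace_pairing (T F) (A m)) \<longlonglongrightarrow> trace_pairing (T F) L"
    unfolding T[OF A(1)] T[OF L(1)] by (intro tendsto_sum lim)
  then obtain M where M: "\<And>m. m \<ge> M \<Longrightarrow> norm (trace_pairing (T F) (A m) - trace_pairing (T F) L) < \<epsilon> / 3"
    using e by (metis LIMSEQ_D zero_less_divide_iff zero_less_numeral)
  have "norm (trace_pairing B (A m) - trace_pairing B L) < \<epsilon>" if "m \<ge> M" for m
    using near[OF A(1) A(2), of m] near[OF L] M[OF that] unfolding real_norm_def by linarith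
  then show "\<exists>M. \<forall>m\<ge>M. norm (trace_pairing B (A m) - trace_pairing B L) < \<epsilon>" by blast
qed

section \<open>Countable coordinates on the cone\<close>

text \<open>
  The last coordinate is the pairing with \<open>(0, 1)\<close>, hence weak-* continuous.  On the cone it dominates the
  trace, so it also controls boundedness.
\<close>

definition cone_coords ::
    "(nat \<Rightarrow> 'a::{real_inner,complete_space}) \<Rightarrow> ('a \<Rightarrow>\<^sub>L 'a) \<times> real \<Rightarrow> (nat \<times> nat \<Rightarrow> real) \<times> real" where
  "cone_coords d = (\<lambda>(A, x). ((\<lambda>(i, j). blinfun_apply A (d i) \<bullet> d j), trace_op A + x))"

lemma cone_coords_inj:
  fixes d :: "nat \<Rightarrow> 'a::{real_inner,complete_space}"
  assumes d: "closure (range d) = UNIV"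
  shows "inj (cone_coords d)"
proof (rule injI)
  fix p q :: "('a \<Rightarrow>\<^sub>L 'a) \<times> real"
  assume eq: "cone_coords d p = cone_coords d q"
  obtain A x B y where pq: "p = (A, x)" "q = (B, y)" by (metis surj_pair)
  have coords: "(\<lambda>(i, j). A (d i) \<bullet> d j) = (\<lambda>(i, j). B (d i) \<bullet> d j)" "trace_op A + x = trace_op B + y"
    using eq by (auto simp: cone_coords_def pq)
  have "A (d i) \<bullet> d j = B (d i) \<bullet> d j" for i j using fun_cong[OF coords(1), of "(i, j)"] by simp
  then have "A = B" by (rule blinfun_eq_if_forms_agree_on_dense[OF d])
  then show "p = q" using coords(2) pq by simp
qed

text \<open>
  The heart of the compactness and metrizability proofs: convergence of countably many numbers forces
  the existence of a limit in the cone and the convergence of all weak-* functionals.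
\<close>

lemma cone_coords_limit:
  fixes d :: "nat \<Rightarrow> 'a::{real_inner,complete_space}" and p :: "nat \<Rightarrow> ('a \<Rightarrow>\<^sub>L 'a) \<times> real"
  assumes sep: "separable_space (euclidean :: 'a topology)"
    and d: "closure (range d) = UNIV"
    and p: "\<And>m. p m \<in> S1_plus \<times> {0..}"
    and lim: "(\<lambda>m. cone_coords d (p m)) \<longlonglongrightarrow> z"
  shows "\<exists>q \<in> S1_plus \<times> {0..}. cone_coords d q = z \<and>
    (\<forall>B y. compact_op B \<longrightarrow> (\<lambda>m. pairing (p m) (B, y)) \<longlonglongrightarrow> pairing q (B, y))"
proof -
  define A where "A m = fst (p m)" for m
  define x where "x m = snd (p m)" for m
  define N where "N m = trace_op (A m) + x m" for m
  have pm: "p m = (A m, x m)" for m by (simp add: A_def x_def)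
  have A: "A m \<in> S1_plus" and x: "0 \<le> x m" for m using p[of m] by (auto simp: pm)
  have N: "N \<longlonglongrightarrow> snd z"
    using tendsto_snd[OF lim] by (simp add: cone_coords_def pm N_def[abs_def])
  have entries: "(\<lambda>m. A m (d i) \<bullet> d j) \<longlonglongrightarrow> fst z (i, j)" for i j
  proof -
    have "(\<lambda>m. fst (cone_coords d (p m)) (i, j)) \<longlonglongrightarrow> fst z (i, j)"
      by (rule continuous_on_tendsto_compose[OF continuous_on_product_coordinates tendsto_fst[OF lim]]) auto
    then show ?thesis by (simp add: cone_coords_def pm)
  qed
  have "Bseq N" using N convergent_def convergent_imp_Bseq by blast
  then obtain c where c: "0 < c" "\<And>m. \<bar>N m\<bar> \<le> c" by (auto elim: BseqE)
  have trA: "trace_op (A m) \<le> N m" "trace_op (A m) \<le> c" for m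
    using c(2)[of m] x[of m] by (auto simp: N_def)
  have bound: "\<bar>A m u \<bullet> w\<bar> \<le> c * norm u * norm w" for m u w
    by (rule order_trans[OF S1_plus_form_bound[OF sep A]]) (intro mult_right_mono trA norm_ge_zero)
  have "\<exists>L. \<forall>u w. (\<lambda>m. A m u \<bullet> w) \<longlonglongrightarrow> blinfun_apply L u \<bullet> w"
    by (rule bounded_forms_converge_if_on_dense[OF d bound]) (use entries in \<open>auto simp: convergent_def\<close>)
  then obtain L where L_all: "\<forall>u w. (\<lambda>m. A m u \<bullet> w) \<longlonglongrightarrow> blinfun_apply L u \<bullet> w" ..
  then have L: "(\<lambda>m. A m u \<bullet> w) \<longlonglongrightarrow> L u \<bullet> w" for u w by simp
  have plus: "L \<in> S1_plus" "trace_op L \<le> snd z"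
    using S1_plus_limit[OF sep A L N trA(1)] by auto
  \<comment> \<open>The trace of the limit may be smaller than the limit of the traces.  The second component
    absorbs the missing mass.\<close>
  define q where "q = (L, snd z - trace_op L)"
  have "q \<in> S1_plus \<times> {0..}" using plus by (simp add: q_def)
  moreover have "cone_coords d q = z"
  proof -
    have "L (d i) \<bullet> d j = fst z (i, j)" for i j by (rule LIMSEQ_unique[OF L entries])
    then show ?thesis by (auto simp: cone_coords_def q_def intro!: prod_eqI)
  qed
  moreover have "(\<lambda>m. pairing (p m) (B, y)) \<longlonglongrightarrow> pairing q (B, y)" if B: "compact_op B" for B y
  proof -
    have "(\<lambda>m. trace_pairing B (A m) + N m * y) \<longlonglongrightarrow> trace_pairing B L + snd z * y"
      by (intro tendsto_intros N trace_pairing_tendsto[OF sep A trA(2) L B])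
    then show ?thesis by (simp add: pairing_def pm q_def N_def)
  qed
  ultimately show ?thesis by blast
qed

lemma closed_cone_coords_image:
  fixes d :: "nat \<Rightarrow> 'a::{real_inner,complete_space}"
  assumes sep: "separable_space (euclidean :: 'a topology)" and d: "closure (range d) = UNIV"
  shows "closed (cone_coords d ` (S1_plus \<times> {0..}))"
  unfolding closed_sequential_limits
proof (intro allI impI, elim conjE)
  fix w z
  assume "\<forall>n. w n \<in> cone_coords d ` (S1_plus \<times> {0..})" and w: "w \<longlonglongrightarrow> z"
  then have "\<forall>n. \<exists>q. q \<in> S1_plus \<times> {0..} \<and> w n = cone_coords d q" by blast
  from choice[OF this] obtain p
    where "\<forall>n. p n \<in> S1_plus \<times> {0..} \<and> w n = cone_coords d (p n)" ..
  then have p: "p n \<in> S1_plus \<times> {0..}" "w n = cone_coords d (p n)" for n by blast+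
  have "(\<lambda>n. cone_coords d (p n)) \<longlonglongrightarrow> z" using w by (simp add: p(2)[symmetric])
  from cone_coords_limit[OF sep d p(1) this] show "z \<in> cone_coords d ` (S1_plus \<times> {0..})" by blast
qed

text \<open>
  A closed subset of a product of compact intervals, since \<open>tr A \<le> c\<close> bounds every entry.
\<close>

lemma compact_cone_coords_image:
  fixes d :: "nat \<Rightarrow> 'a::{real_inner,complete_space}"
  assumes sep: "separable_space (euclidean :: 'a topology)" and d: "closure (range d) = UNIV"
  shows "compact (cone_coords d ` {p \<in> S1_plus \<times> {0..}. snd (cone_coords d p) \<le> c})"
proof -
  define K where "K = (S1_plus \<times> {0..} :: (('a \<Rightarrow>\<^sub>L 'a) \<times> real) set)"
  define Q where "Q = (\<Pi>\<^sub>E k \<in> (UNIV :: (nat \<times> nat) set).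
      {- (c * norm (d (fst k)) * norm (d (snd k))) .. c * norm (d (fst k)) * norm (d (snd k))})"
  have "compactin (product_topology (\<lambda>_. euclideanreal) UNIV) Q"
    unfolding Q_def compactin_PiE by simp
  then have "compact Q" by (simp add: euclidean_product_topology)
  then have box: "compact (Q \<times> {0..c})" by (rule compact_Times) simp
  have "cone_coords d ` {p \<in> K. snd (cone_coords d p) \<le> c} = cone_coords d ` K \<inter> {z. snd z \<le> c}" by auto
  moreover have "closed (cone_coords d ` K \<inter> {z. snd z \<le> c})"
    unfolding K_def
    by (intro closed_Int closed_cone_coords_image[OF sep d] closed_Collect_le continuous_intros)
  ultimately have cl: "closed (cone_coords d ` {p \<in> K. snd (cone_coords d p) \<le> c})" by simp
  have sub: "cone_coords d ` {p \<in> K. snd (cone_coords d p) \<le> c} \<subseteq> Q \<times> {0..c}"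
  proof (rule image_subsetI)
    fix p assume p: "p \<in> {p \<in> K. snd (cone_coords d p) \<le> c}"
    obtain A x where Ax: "p = (A, x)" by force
    have A: "A \<in> S1_plus" and x: "0 \<le> x" and c: "trace_op A + x \<le> c"
      using p by (auto simp: K_def Ax cone_coords_def)
    have trA: "0 \<le> trace_op A" by (rule trace_nonneg[OF sep A])
    have "\<bar>A (d i) \<bullet> d j\<bar> \<le> c * norm (d i) * norm (d j)" for i j
      by (rule order_trans[OF S1_plus_form_bound[OF sep A]])
         (use x c in \<open>intro mult_right_mono norm_ge_zero, linarith\<close>)
    then have "(\<lambda>(i, j). A (d i) \<bullet> d j) \<in> Q"
      by (auto simp: Q_def abs_le_iff minus_le_iff)
    then show "cone_coords d p \<in> Q \<times> {0..c}"
      using trA x c by (simp add: cone_coords_def Ax)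
  qed
  have "compact (Q \<times> {0..c} \<inter> cone_coords d ` {p \<in> K. snd (cone_coords d p) \<le> c})"
    by (rule compact_Int_closed[OF box cl])
  then show ?thesis using sub by (simp add: K_def inf_absorb2)
qed

section \<open>The weak-* topology\<close>

lemma topspace_wstar:
  "topspace (wstar_topology :: (('a::{real_inner,complete_space} \<Rightarrow>\<^sub>L 'a) \<times> real) topology) = L1 \<times> UNIV"
proof -
  have "\<exists>q U. (L1 :: ('a \<Rightarrow>\<^sub>L 'a) set) \<times> (UNIV :: real set) = {p \<in> L1 \<times> UNIV. pairing p q \<in> U} \<and>
      q \<in> {B. compact_op B} \<times> UNIV \<and> open U"
    by (rule exI[of _ "(0, 0)"], rule exI[of _ UNIV]) (auto simp: compact_op_0)
  then show ?thesis
    unfolding wstar_topology_def topology_generated_by_topspace by blast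
qed

lemma continuous_map_pairing:
  assumes "compact_op B"
  shows "continuous_map wstar_topology euclideanreal (\<lambda>p. pairing p (B, y))"
  unfolding continuous_map
proof (intro conjI allI impI)
  fix U :: "real set" assume "openin euclideanreal U"
  then have "open U" by simp
  then show "openin wstar_topology {p \<in> topspace wstar_topology. pairing p (B, y) \<in> U}"
    unfolding topspace_wstar unfolding wstar_topology_def
    using assms by (intro topology_generated_by_Basis) blast
qed auto

lemma cone_subset_topspace_wstar: "S1_plus \<times> {0..} \<subseteq> topspace wstar_topology"
  by (auto simp: topspace_wstar S1_plus_def S1_def)

lemma continuous_map_cone_coords:
  fixes d :: "nat \<Rightarrow> 'a::{real_inner,complete_space}"
  assumes sep: "separable_space (euclidean :: 'a topology)"
  shows "continuous_map (subtopology wstar_topology (S1_plus \<times> {0..})) euclidean (cone_coords d)"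
proof -
  define \<tau> where "\<tau> = subtopology (wstar_topology :: (('a \<Rightarrow>\<^sub>L 'a) \<times> real) topology) (S1_plus \<times> {0..})"
  have top: "topspace \<tau> = S1_plus \<times> {0..}"
    using cone_subset_topspace_wstar by (auto simp: \<tau>_def)
  have cont: "continuous_map \<tau> euclideanreal (\<lambda>p. pairing p (B, y))" if "compact_op B" for B y
    unfolding \<tau>_def by (intro continuous_map_from_subtopology continuous_map_pairing that)
  have entry: "continuous_map \<tau> euclideanreal (\<lambda>p. fst (cone_coords d p) k)" for k
  proof (rule continuous_map_eq[OF cont[OF compact_op_rank_one, of "d (snd k)" "d (fst k)" 0]])
    fix p assume "p \<in> topspace \<tau>"
    then obtain A x where p: "p = (A, x)" "A \<in> S1_plus" by (auto simp: top)
    show "pairing p (rank_one_op (d (snd k)) (d (fst k)), 0) = fst (cone_coords d p) k"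
      by (simp add: p(1) pairing_def cone_coords_def split_def
          trace_pairing_rank_one[OF sep S1_plus_imp_selfadjoint[OF p(2)]])
  qed
  have snd: "continuous_map \<tau> euclideanreal (\<lambda>p. snd (cone_coords d p))"
  proof (rule continuous_map_eq[OF cont[OF compact_op_0, of 1]])
    fix p assume "p \<in> topspace \<tau>"
    then obtain A x where p: "p = (A, x)" "A \<in> S1_plus" by (auto simp: top)
    show "pairing p (0, 1) = snd (cone_coords d p)"
      using trace_pairing_scaleR[OF sep p(2), of 0 0] by (simp add: p(1) pairing_def cone_coords_def)
  qed
  have fst: "continuous_map \<tau> euclidean (\<lambda>p. fst (cone_coords d p))"
    unfolding euclidean_product_topology[symmetric] continuous_map_componentwise_UNIV
    using entry by blast
  have "continuous_map \<tau> (prod_topology euclidean euclidean) (cone_coords d)"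
    unfolding continuous_map_pairwise comp_def using fst snd by blast
  then show ?thesis by (simp add: \<tau>_def)
qed

text \<open>
  The coordinate space is metrizable, so continuity of the inverse may be tested on sequences, where
  the preceding limit lemma applies.
\<close>

lemma homeomorphic_maps_cone_coords:
  fixes d :: "nat \<Rightarrow> 'a::{real_inner,complete_space}"
  assumes sep: "separable_space (euclidean :: 'a topology)" and d: "closure (range d) = UNIV"
  shows "homeomorphic_maps (subtopology wstar_topology (S1_plus \<times> {0..}))
    (top_of_set (cone_coords d ` (S1_plus \<times> {0..}))) (cone_coords d) (inv (cone_coords d))"
proof -
  define K where "K = (S1_plus \<times> {0..} :: (('a \<Rightarrow>\<^sub>L 'a) \<times> real) set)"
  define \<Phi> where "\<Phi> = cone_coords d"
  have inv: "inv \<Phi> (\<Phi> p) = p" for p using cone_coords_inj[OF d] by (simp add: \<Phi>_def)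
  have top: "topspace (subtopology wstar_topology K) = K"
    using cone_subset_topspace_wstar by (auto simp: K_def)
  have pair: "continuous_on (\<Phi> ` K) (\<lambda>z. pairing (inv \<Phi> z) (B, y))" if B: "compact_op B" for B y
    unfolding continuous_on_sequentially
  proof (intro allI ballI impI, elim conjE)
    fix w z assume "\<forall>n. w n \<in> \<Phi> ` K" and w: "w \<longlonglongrightarrow> z"
    then have "\<forall>n. \<exists>q. q \<in> K \<and> w n = \<Phi> q" by blast
    from choice[OF this] obtain p where "\<forall>n. p n \<in> K \<and> w n = \<Phi> (p n)" ..
    then have p: "p n \<in> S1_plus \<times> {0..}" "w n = \<Phi> (p n)" for n unfolding K_def by blast+
    have "(\<lambda>n. cone_coords d (p n)) \<longlonglongrightarrow> z" using w by (simp add: p(2)[symmetric] \<Phi>_def[symmetric])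
    from cone_coords_limit[OF sep d p(1) this] B
    obtain q where q: "\<Phi> q = z" "(\<lambda>m. pairing (p m) (B, y)) \<longlonglongrightarrow> pairing q (B, y)"
      unfolding \<Phi>_def by blast
    show "((\<lambda>z. pairing (inv \<Phi> z) (B, y)) \<circ> w) \<longlonglongrightarrow> pairing (inv \<Phi> z) (B, y)"
      using q(2) by (simp add: comp_def p(2) inv q(1)[symmetric])
  qed
  have "continuous_map (top_of_set (\<Phi> ` K)) wstar_topology (inv \<Phi>)"
    unfolding wstar_topology_def
  proof (rule continuous_on_generated_topo)
    have "inv \<Phi> ` \<Phi> ` K \<subseteq> topspace wstar_topology"
      using cone_subset_topspace_wstar by (auto simp: inv K_def)
    then show "inv \<Phi> ` topspace (top_of_set (\<Phi> ` K)) \<subseteq>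
        \<Union> {{p \<in> L1 \<times> UNIV. pairing p q \<in> U} | q U. q \<in> {B. compact_op B} \<times> UNIV \<and> open U}"
      unfolding wstar_topology_def topology_generated_by_topspace by simp
    fix V :: "(('a \<Rightarrow>\<^sub>L 'a) \<times> real) set"
    assume "V \<in> {{p \<in> L1 \<times> UNIV. pairing p q \<in> U} | q U. q \<in> {B. compact_op B} \<times> UNIV \<and> open U}"
    then obtain B y U where B: "compact_op B" and U: "open U"
      and V: "V = {p \<in> L1 \<times> UNIV. pairing p (B, y) \<in> U}" by auto
    have "inv \<Phi> -` V \<inter> topspace (top_of_set (\<Phi> ` K)) = \<Phi> ` K \<inter> (\<lambda>z. pairing (inv \<Phi> z) (B, y)) -` U"
      using cone_subset_topspace_wstar unfolding topspace_wstar by (auto simp: V inv K_def)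
    moreover have "openin (top_of_set (\<Phi> ` K)) \<dots>"
      by (rule continuous_openin_preimage_gen[OF pair[OF B] U])
    ultimately show "openin (top_of_set (\<Phi> ` K)) (inv \<Phi> -` V \<inter> topspace (top_of_set (\<Phi> ` K)))"
      by simp
  qed
  then have inv_cont: "continuous_map (top_of_set (\<Phi> ` K)) (subtopology wstar_topology K) (inv \<Phi>)"
    by (rule continuous_map_into_subtopology) (auto simp: inv)
  have "continuous_map (subtopology wstar_topology K) (top_of_set (\<Phi> ` K)) \<Phi>"
    unfolding K_def \<Phi>_def
    by (rule continuous_map_into_subtopology[OF continuous_map_cone_coords[OF sep]])
       (use top in \<open>auto simp: K_def\<close>)
  then have "homeomorphic_maps (subtopology wstar_topology K) (top_of_set (\<Phi> ` K)) \<Phi> (inv \<Phi>)"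
    unfolding homeomorphic_maps_def using inv_cont by (auto simp: inv)
  then show ?thesis by (simp add: K_def \<Phi>_def)
qed

lemma compactin_cone_slice:
  fixes d :: "nat \<Rightarrow> 'a::{real_inner,complete_space}"
  assumes sep: "separable_space (euclidean :: 'a topology)" and d: "closure (range d) = UNIV"
  shows "compactin (subtopology wstar_topology (S1_plus \<times> {0..}))
    {p \<in> S1_plus \<times> {0..}. snd (cone_coords d p) \<le> c}" (is "compactin ?X ?F")
proof -
  have "compactin (top_of_set (cone_coords d ` (S1_plus \<times> {0..}))) (cone_coords d ` ?F)"
    using compact_cone_coords_image[OF sep d, of c] by (auto simp: compactin_subtopology)
  then have "compactin ?X (inv (cone_coords d) ` (cone_coords d ` ?F))"
    by (rule image_compactin) (use homeomorphic_maps_cone_coords[OF sep d] in \<open>simp add: homeomorphic_maps_def\<close>)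
  then show ?thesis by (simp add: image_image inv_f_f[OF cone_coords_inj[OF d]])
qed

lemma separable_space_top_of_set:
  fixes S :: "'b::{metric_space,second_countable_topology} set"
  shows "separable_space (top_of_set S)"
proof -
  obtain T where "countable T" "T \<subseteq> S" "S \<subseteq> closure T" by (rule separable)
  then show ?thesis
    unfolding separable_space_def by (intro exI[of _ T]) (auto simp: closure_of_subtopology inf_absorb2)
qed

text \<open>
  By duality the cone is an intersection of closed half-spaces.
\<close>

lemma closedin_cone:
  assumes sep: "separable_space (euclidean :: 'a::{real_inner,complete_space} topology)"
  shows "closedin (subtopology wstar_topology (S1 \<times> UNIV))
    (S1_plus \<times> {0..} :: (('a \<Rightarrow>\<^sub>L 'a) \<times> real) set)"
proof -
  define W where "W = subtopology (wstar_topology :: (('a \<Rightarrow>\<^sub>L 'a) \<times> real) topology) (S1 \<times> UNIV)"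
  define D where "D = {(B :: 'a \<Rightarrow>\<^sub>L 'a, y :: real). B \<in> Sc \<and> 0 \<le> y \<and> nonneg_op (B + y *\<^sub>R id_blinfun)}"
  have top: "topspace W = S1 \<times> UNIV" by (auto simp: W_def topspace_wstar S1_def)
  have half: "closedin W {p \<in> topspace W. 0 \<le> pairing p q}" if "q \<in> D" for q
  proof -
    obtain B y where q: "q = (B, y)" "compact_op B" using \<open>q \<in> D\<close> by (auto simp: D_def Sc_def)
    have "continuous_map W euclideanreal (\<lambda>p. pairing p q)"
      unfolding W_def q(1) by (intro continuous_map_from_subtopology continuous_map_pairing q)
    from closedin_continuous_map_preimage[OF this, of "{0..}"] show ?thesis by simp
  qed
  have "S1_plus \<times> {0..} = topspace W \<inter> (\<Inter>q\<in>D. {p \<in> topspace W. 0 \<le> pairing p q})"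
  proof (intro equalityI subsetI)
    fix p assume "p \<in> topspace W \<inter> (\<Inter>q\<in>D. {p \<in> topspace W. 0 \<le> pairing p q})"
    then show "p \<in> S1_plus \<times> {0..}"
      using mem_cone_if_pairing_nonneg[OF sep, of "fst p" "snd p"]
      by (cases p) (auto simp: top D_def)
  next
    fix p :: "('a \<Rightarrow>\<^sub>L 'a) \<times> real" assume "p \<in> S1_plus \<times> {0..}"
    then show "p \<in> topspace W \<inter> (\<Inter>q\<in>D. {p \<in> topspace W. 0 \<le> pairing p q})"
      using pairing_nonneg[OF sep, of "fst p" "snd p"] by (cases p) (auto simp: top D_def S1_plus_def)
  qed
  moreover have "closedin W (topspace W \<inter> (\<Inter>q\<in>D. {p \<in> topspace W. 0 \<le> pairing p q}))"
  proof (cases "D = {}")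
    case False
    then show ?thesis using half by (intro closedin_Int closedin_topspace closedin_INT) auto
  qed simp
  ultimately show ?thesis by (simp add: W_def)
qed

theorem proposition5p1:
  fixes K :: "(('a::{real_inner,complete_space} \<Rightarrow>\<^sub>L 'a) \<times> real) set"
    and \<tau> :: "(('a \<Rightarrow>\<^sub>L 'a) \<times> real) topology"
  assumes separable: "separable_space (euclidean :: 'a topology)"
    and K_eq: "K = S1_plus \<times> {0..}"
    and tau_eq: "\<tau> = subtopology wstar_topology K"
  shows
    "(K \<subseteq> S1 \<times> UNIV \<and> convex_cone K) \<and>
     (\<forall>(A, x) \<in> S1 \<times> UNIV.
        (A, x) \<in> K \<longleftrightarrow>
        (\<forall>(B, y) \<in> Sc \<times> {0..}.
           nonneg_op (B + y *\<^sub>R id_blinfun) \<longrightarrow> 0 \<le> pairing (A, x) (B, y))) \<and>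
     closedin (subtopology wstar_topology (S1 \<times> UNIV)) K \<and>
     (sigma_compact_space \<tau> \<and> locally_compact_space \<tau>) \<and>
     (separable_space \<tau> \<and> metrizable_space \<tau>)"
proof -
  obtain d :: "nat \<Rightarrow> 'a" where d: "closure (range d) = UNIV"
    using separable_dense_sequence[OF separable] by blast
  define N where "N p = snd (cone_coords d p)" for p
  have top: "topspace \<tau> = K"
    using cone_subset_topspace_wstar by (auto simp: tau_eq K_eq)
  have slice: "compactin \<tau> {p \<in> K. N p \<le> c}" for c
    unfolding tau_eq K_eq N_def by (rule compactin_cone_slice[OF separable d])
  have N_cont: "continuous_map \<tau> euclideanreal N"
  proof -
    have "continuous_map \<tau> (prod_topology euclidean euclidean) (cone_coords d)"
      unfolding prod_topology_euclidean tau_eq K_eq by (rule continuous_map_cone_coords[OF separable])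
    then show ?thesis unfolding continuous_map_pairwise by (simp add: comp_def N_def[abs_def])
  qed
  have homeo: "\<tau> homeomorphic_space top_of_set (cone_coords d ` K)"
    unfolding homeomorphic_space_def tau_eq K_eq using homeomorphic_maps_cone_coords[OF separable d] by blast

  have "K \<subseteq> S1 \<times> UNIV" by (auto simp: K_eq S1_plus_def)
  moreover have "convex_cone K"
    using convex_cone_S1_plus[OF separable] by (auto simp: K_eq convex_cone_iff zero_prod_def)
  moreover have "\<forall>(A, x) \<in> S1 \<times> UNIV. (A, x) \<in> K \<longleftrightarrow>
      (\<forall>(B, y) \<in> Sc \<times> {0..}. nonneg_op (B + y *\<^sub>R id_blinfun) \<longrightarrow> 0 \<le> pairing (A, x) (B, y))"
  proof (clarify, intro iffI)
    fix A :: "'a \<Rightarrow>\<^sub>L 'a" and x :: real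
    assume "(A, x) \<in> K"
    then show "\<forall>(B, y) \<in> Sc \<times> {0..}. nonneg_op (B + y *\<^sub>R id_blinfun) \<longrightarrow> 0 \<le> pairing (A, x) (B, y)"
      using pairing_nonneg[OF separable, of A x] by (auto simp: K_eq)
  next
    fix A :: "'a \<Rightarrow>\<^sub>L 'a" and x :: real
    assume "A \<in> S1"
      and "\<forall>(B, y) \<in> Sc \<times> {0..}. nonneg_op (B + y *\<^sub>R id_blinfun) \<longrightarrow> 0 \<le> pairing (A, x) (B, y)"
    then show "(A, x) \<in> K"
      using mem_cone_if_pairing_nonneg[OF separable, of A x] by (auto simp: K_eq)
  qed
  moreover have "closedin (subtopology wstar_topology (S1 \<times> UNIV)) K"
    unfolding K_eq by (rule closedin_cone[OF separable])
  moreover have "sigma_compact_space \<tau>"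
    unfolding sigma_compact_space_def
  proof (intro exI conjI allI)
    show "compactin \<tau> {p \<in> K. N p \<le> real n}" for n by (rule slice)
    show "(\<Union>n. {p \<in> K. N p \<le> real n}) = topspace \<tau>"
      using real_arch_simple by (auto simp: top)
  qed
  moreover have "locally_compact_space \<tau>"
    unfolding locally_compact_space_def
  proof
    fix p assume p: "p \<in> topspace \<tau>"
    have "openin \<tau> {q \<in> topspace \<tau>. N q \<in> {..<N p + 1}}"
      by (rule openin_continuous_map_preimage[OF N_cont]) simp
    then show "\<exists>U C. openin \<tau> U \<and> compactin \<tau> C \<and> p \<in> U \<and> U \<subseteq> C"
      using p slice[of "N p + 1"]
      by (intro exI[of _ "{q \<in> topspace \<tau>. N q \<in> {..<N p + 1}}"] exI[of _ "{q \<in> K. N q \<le> N p + 1}"])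
         (auto simp: top)
  qed
  moreover have "separable_space \<tau>"
    using homeomorphic_separable_space[OF homeo] separable_space_top_of_set by blast
  moreover have "metrizable_space \<tau>"
    using homeomorphic_metrizable_space[OF homeo] metrizable_space_subtopology[OF metrizable_space_euclidean]
    by blast
  ultimately show ?thesis by blast
qed

end
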